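(* Let $P$ be the group of pinors generated, under the geometric product in the Clifford algebra $\mathrm{Cl}(3)$, by the simple roots of $H_3$ $$\alpha_1=e_2,\qquad \alpha_2=-\tfrac12\big((\tau-1)e_1+e_2+\tau e_3\big),\qquad \alpha_3=e_3 .$$ Then $P$ has $240$ elements (doubly covering the $120$ elements of the icosahedral reflection group $H_3$), and these $240$ pinors, endowed with the reduced inner product $(\cdot,\cdot)_\tau$ described in the context, form the root system of type $E_8$. That is, writing $G\subset P$ for the subgroup of even elements (the $120$ spinors) and $I=e_1e_2e_3$, one has $P=G\cup IG$, and the set $$\Phi=\{R : R\in G\}\cup\{\tau I\,Q : Q\in IG\}$$ consists of $240$ elements and is a root system of type $E_8$ with respect to $(\cdot,\cdot)_\tau$.
   Context: $\mathrm{Cl}(3)$ is the real Clifford algebra generated by orthonormal vectors $e_1,e_2,e_3$ with $e_i^2=1$, $e_ie_j=-e_je_i$ for $i\ne j$. It is 8-dimensional, with basis $1$; $e_1,e_2,e_3$; $e_2e_3,e_3e_1,e_1e_2$; $I=e_1e_2e_3$ (so $I^2=-1$ and $I$ is central). $\tau=\frac12(1+\sqrt5)$, so $\tau^2=\tau+1$. A product of unit (root) vectors is called a pinor; a product of an even number of them is called a spinor. A pinor $A$ acts on vectors by $v\mapsto\pm\tilde A vA$, where $\tilde A$ denotes reversal of the order of the vector factors; $A$ and $-A$ give the same orthogonal transformation. Inner product: for even elements $R_1,R_2$ (elements of the form $a_0+a_1e_2e_3+a_2e_3e_1+a_3e_1e_2$) put $(R_1,R_2)=\frac12(R_1\tilde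 R_2+R_2\tilde R_1)$, i.e. the standard Euclidean inner product of the coefficient vectors $(a_0,a_1,a_2,a_3)$. Reduced inner product: the elements of $\Phi$ have coefficients in $\mathbb{Q}(\tau)=\{a+\tau b: a,b\in\mathbb{Q}\}$, so their inner products lie in $\mathbb{Q}(\tau)$. If $(x,y)=a+\tau b$ with $a,b\in\mathbb{Q}$, define $(x,y)_\tau:=a$. This is a symmetric $\mathbb{Q}$-bilinear form on the 8-dimensional $\mathbb{Q}$-vector space of elements $a_0+a_1e_2e_3+a_2e_3e_1+a_3e_1e_2$ with $a_i\in\mathbb{Q}(\tau)$; extend scalars from $\mathbb{Q}$ to $\mathbb{R}$ to obtain an 8-dimensional real vector space with bilinear form. Root system: a collection $\Phi$ of non-zero vectors spanning a Euclidean vector space $V$ with positive definite bilinear form $(\cdot|\cdot)$ such that (1) $\Phi\cap\mathbb{R}\alpha=\{\alpha,-\alpha\}$ for all $\alpha\in\Phi$, and (2) $\Phi$ is invariant under every reflection $s_\alpha:\lambda\mapsto\lambda-2\frac{(\lambda|\alpha)}{(\alpha|\alpha)}\alpha$, $\alpha\in\Phi$. *)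

theory Defs
  imports "HOL-Analysis.Analysis" "HOL-Algebra.Generated_Groups"
begin

section \<open>The Clifford algebra \<open>Cl(3)\<close>\<close>

text \<open>
  An element is given by its eight coordinates with respect to the basis
  \<open>1; e1, e2, e3; e2 e3, e3 e1, e1 e2; e1 e2 e3\<close>.
\<close>

datatype cl3 = Cl3 (c0: real) (c1: real) (c2: real) (c3: real)
                   (c23: real) (c31: real) (c12: real) (c123: real)

lemma cl3_eq_iff:
  "x = y \<longleftrightarrow> c0 x = c0 y \<and> c1 x = c1 y \<and> c2 x = c2 y \<and> c3 x = c3 y \<and>
     c23 x = c23 y \<and> c31 x = c31 y \<and> c12 x = c12 y \<and> c123 x = c123 y"
  by (cases x; cases y) auto

instantiation cl3 :: ring_1
begin

definition "0 = Cl3 0 0 0 0 0 0 0 0"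
definition "1 = Cl3 1 0 0 0 0 0 0 0"
definition "x + y = Cl3 (c0 x + c0 y) (c1 x + c1 y) (c2 x + c2 y) (c3 x + c3 y)
  (c23 x + c23 y) (c31 x + c31 y) (c12 x + c12 y) (c123 x + c123 y)"
definition "- x = Cl3 (- c0 x) (- c1 x) (- c2 x) (- c3 x)
  (- c23 x) (- c31 x) (- c12 x) (- c123 x)"
definition "x - y = Cl3 (c0 x - c0 y) (c1 x - c1 y) (c2 x - c2 y) (c3 x - c3 y)
  (c23 x - c23 y) (c31 x - c31 y) (c12 x - c12 y) (c123 x - c123 y)"

text \<open>
  The product is determined by \<open>I = e1 e2 e3\<close> being central with \<open>I\<^sup>2 = -1\<close>, by
  \<open>e2 e3 = I e1\<close>, \<open>e3 e1 = I e2\<close>, \<open>e1 e2 = I e3\<close>, and by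
  \<open>u v = u \<bullet> v + I (u \<times> v)\<close> for vectors \<open>u\<close>, \<open>v\<close>. That this is the Clifford
  product follows from the ring axioms and the relations proved below.
\<close>

definition "x * y = Cl3
  (c0 x * c0 y + c1 x * c1 y + c2 x * c2 y + c3 x * c3 y
     - c23 x * c23 y - c31 x * c31 y - c12 x * c12 y - c123 x * c123 y)
  (c0 x * c1 y + c1 x * c0 y - c123 x * c23 y - c23 x * c123 y
     - (c2 x * c12 y - c3 x * c31 y) - (c31 x * c3 y - c12 x * c2 y))
  (c0 x * c2 y + c2 x * c0 y - c123 x * c31 y - c31 x * c123 y
     - (c3 x * c23 y - c1 x * c12 y) - (c12 x * c1 y - c23 x * c3 y))
  (c0 x * c3 y + c3 x * c0 y - c123 x * c12 y - c12 x * c123 y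
     - (c1 x * c31 y - c2 x * c23 y) - (c23 x * c2 y - c31 x * c1 y))
  (c0 x * c23 y + c23 x * c0 y + c123 x * c1 y + c1 x * c123 y
     + (c2 x * c3 y - c3 x * c2 y) - (c31 x * c12 y - c12 x * c31 y))
  (c0 x * c31 y + c31 x * c0 y + c123 x * c2 y + c2 x * c123 y
     + (c3 x * c1 y - c1 x * c3 y) - (c12 x * c23 y - c23 x * c12 y))
  (c0 x * c12 y + c12 x * c0 y + c123 x * c3 y + c3 x * c123 y
     + (c1 x * c2 y - c2 x * c1 y) - (c23 x * c31 y - c31 x * c23 y))
  (c0 x * c123 y + c123 x * c0 y + c1 x * c23 y + c2 x * c31 y + c3 x * c12 y
     + c23 x * c1 y + c31 x * c2 y + c12 x * c3 y)"

instance
proof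
  fix x y z :: cl3
  show "x * y * z = x * (y * z)"
    by (simp add: times_cl3_def) (intro conjI; algebra)
  show "(x + y) * z = x * z + y * z"
    by (simp add: times_cl3_def plus_cl3_def algebra_simps)
  show "x * (y + z) = x * y + x * z"
    by (simp add: times_cl3_def plus_cl3_def algebra_simps)
qed (simp_all add: cl3_eq_iff zero_cl3_def one_cl3_def plus_cl3_def uminus_cl3_def
      minus_cl3_def times_cl3_def)

end

instantiation cl3 :: real_algebra_1
begin

definition "r *\<^sub>R x = Cl3 (r * c0 x) (r * c1 x) (r * c2 x) (r * c3 x)
  (r * c23 x) (r * c31 x) (r * c12 x) (r * c123 x)"

instance
  by standard
    (simp_all add: cl3_eq_iff scaleR_cl3_def plus_cl3_def times_cl3_def algebra_simps)

end

lemmas cl3_defs = zero_cl3_def one_cl3_def plus_cl3_def uminus_cl3_def minus_cl3_def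
  times_cl3_def scaleR_cl3_def

definition e1 :: cl3 where "e1 = Cl3 0 1 0 0 0 0 0 0"
definition e2 :: cl3 where "e2 = Cl3 0 0 1 0 0 0 0 0"
definition e3 :: cl3 where "e3 = Cl3 0 0 0 1 0 0 0 0"
definition cl_I :: cl3 where "cl_I = e1 * e2 * e3"

lemma clifford_relations:
  "e1 * e1 = 1" "e2 * e2 = 1" "e3 * e3 = 1"
  "e1 * e2 = - (e2 * e1)" "e2 * e3 = - (e3 * e2)" "e3 * e1 = - (e1 * e3)"
  by (simp_all add: cl3_defs e1_def e2_def e3_def)

lemma cl3_basis_expansion:
  "x = c0 x *\<^sub>R 1 + c1 x *\<^sub>R e1 + c2 x *\<^sub>R e2 + c3 x *\<^sub>R e3
     + c23 x *\<^sub>R (e2 * e3) + c31 x *\<^sub>R (e3 * e1) + c12 x *\<^sub>R (e1 * e2) + c123 x *\<^sub>R cl_I"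
  by (simp add: cl3_eq_iff cl3_defs e1_def e2_def e3_def cl_I_def)

definition cl_even :: "cl3 \<Rightarrow> bool" where
  "cl_even x \<longleftrightarrow> c1 x = 0 \<and> c2 x = 0 \<and> c3 x = 0 \<and> c123 x = 0"

definition cl_rev :: "cl3 \<Rightarrow> cl3" where
  "cl_rev x = Cl3 (c0 x) (c1 x) (c2 x) (c3 x) (- c23 x) (- c31 x) (- c12 x) (- c123 x)"

definition cl_vec :: "real^3 \<Rightarrow> cl3" where
  "cl_vec v = (v $ 1) *\<^sub>R e1 + (v $ 2) *\<^sub>R e2 + (v $ 3) *\<^sub>R e3"

definition vec_part :: "cl3 \<Rightarrow> real^3" where
  "vec_part x = vector [c1 x, c2 x, c3 x]"

text \<open>Reversal is the anti-automorphism fixing scalars and vectors.\<close>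

lemma cl_rev_mult: "cl_rev (x * y) = cl_rev y * cl_rev x"
  by (simp add: cl_rev_def times_cl3_def algebra_simps)

lemma cl_rev_vec: "cl_rev (cl_vec v) = cl_vec v"
  by (simp add: cl_rev_def cl_vec_def cl3_defs e1_def e2_def e3_def)

lemma vec_part_cl_vec [simp]: "vec_part (cl_vec v) = v"
  by (simp add: vec_part_def cl_vec_def cl3_defs e1_def e2_def e3_def vec_eq_iff
      forall_3 vector_3)

section \<open>Pinors and the icosahedral reflection group\<close>

definition tau :: real where "tau = (1 + sqrt 5) / 2"

lemma tau_squared: "tau * tau = tau + 1"
proof -
  have "sqrt 5 * sqrt 5 = (5::real)" by simp
  then show ?thesis unfolding tau_def by (simp add: field_simps)
qed

definition alpha1 :: cl3 where "alpha1 = e2"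
definition alpha2 :: cl3 where
  "alpha2 = - ((1 / 2) *\<^sub>R ((tau - 1) *\<^sub>R e1 + e2 + tau *\<^sub>R e3))"
definition alpha3 :: cl3 where "alpha3 = e3"

definition cl3_monoid :: "cl3 monoid" where
  "cl3_monoid = \<lparr>carrier = UNIV, monoid.mult = (*), one = 1\<rparr>"

abbreviation cl3_units :: "cl3 monoid" where
  "cl3_units \<equiv> units_of cl3_monoid"

definition pinors :: "cl3 set" where
  "pinors = generate cl3_units {alpha1, alpha2, alpha3}"

definition spinors :: "cl3 set" where
  "spinors = {A \<in> pinors. cl_even A}"

lemma cl3_monoid: "monoid cl3_monoid"
  by unfold_locales (simp_all add: cl3_monoid_def mult.assoc)

lemma alpha_square: "alpha1 * alpha1 = 1" "alpha2 * alpha2 = 1" "alpha3 * alpha3 = 1"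
proof -
  show "alpha2 * alpha2 = 1"
    using tau_squared
    by (simp add: alpha2_def cl3_defs e1_def e2_def e3_def field_simps)
qed (simp_all add: alpha1_def alpha3_def clifford_relations)

lemma alpha_units: "{alpha1, alpha2, alpha3} \<subseteq> carrier cl3_units"
  using alpha_square by (auto simp: units_of_def Units_def cl3_monoid_def)

definition reflect :: "('v::real_vector \<Rightarrow> 'v \<Rightarrow> real) \<Rightarrow> 'v \<Rightarrow> 'v \<Rightarrow> 'v" where
  "reflect B a v = v - (2 * B v a / B a a) *\<^sub>R a"

definition O3 :: "(real^3 \<Rightarrow> real^3) monoid" where
  "O3 = \<lparr>carrier = {f. orthogonal_transformation f}, monoid.mult = (\<circ>), one = id\<rparr>"

lemma group_O3: "group O3"
proof (rule groupI)
  fix f assume "f \<in> carrier O3"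
  then have f: "orthogonal_transformation f" by (simp add: O3_def)
  then have "orthogonal_transformation (inv_into UNIV f)"
    "inv_into UNIV f \<circ> f = id"
    by (auto simp: orthogonal_transformation_inv orthogonal_transformation_inj)
  then show "\<exists>g\<in>carrier O3. g \<otimes>\<^bsub>O3\<^esub> f = \<one>\<^bsub>O3\<^esub>"
    by (auto simp: O3_def)
qed (auto simp: O3_def orthogonal_transformation_compose comp_assoc
      orthogonal_transformation_id id_def)

lemma reflect_in_O3:
  assumes "a \<noteq> 0"
  shows "reflect (\<bullet>) a \<in> carrier O3"
proof -
  have "linear (reflect (\<bullet>) a)"
    by (rule linearI) (simp_all add: reflect_def inner_simps algebra_simps add_divide_distrib)
  moreover have "reflect (\<bullet>) a v \<bullet> reflect (\<bullet>) a w = v \<bullet> w" for v w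
  proof -
    define n where "n = a \<bullet> a"
    have n: "n \<noteq> 0" using assms by (simp add: n_def)
    have "reflect (\<bullet>) a v \<bullet> reflect (\<bullet>) a w
        = v \<bullet> w - 2 * (w \<bullet> a) / n * (v \<bullet> a) - 2 * (v \<bullet> a) / n * (w \<bullet> a)
          + 2 * (v \<bullet> a) / n * (2 * (w \<bullet> a) / n * n)"
      unfolding reflect_def n_def[symmetric]
      by (simp add: inner_diff_left inner_diff_right n_def[symmetric] inner_commute[of a w])
    then show ?thesis using n by simp
  qed
  ultimately show ?thesis
    by (simp add: O3_def orthogonal_transformation_def)
qed

lemma cos_pi_div_5: "cos (pi / 5) = tau / 2"
proof -
  define c where "c = cos (pi / 5)"
  have c: "c > 0" unfolding c_def by (rule cos_gt_zero) auto
  have "cos (3 * (pi / 5)) = cos (pi - 2 * (pi / 5))" by (simp add: algebra_simps)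
  also have "\<dots> = - cos (2 * (pi / 5))" by (rule cos_pi_minus)
  finally have "4 * c ^ 3 - 3 * c = - (2 * c\<^sup>2 - 1)"
    unfolding c_def by (simp only: cos_treble_cos cos_double_cos)
  then have "(c + 1) * (4 * c\<^sup>2 - 2 * c - 1) = 0"
    by (simp add: algebra_simps power2_eq_square power3_eq_cube)
  with c have "4 * c\<^sup>2 - 2 * c - 1 = 0" by simp
  then have "(2 * c - tau) * (2 * c + tau - 1) = 0"
    using tau_squared by (simp add: algebra_simps power2_eq_square)
  moreover have "tau > 1" by (simp add: tau_def)
  ultimately show ?thesis using c by (auto simp: c_def)
qed

text \<open>The Coxeter diagram is that of \<open>H3\<close>: one edge of order 3 and one of order 5.\<close>

lemma H3_simple_roots:
  "vec_part alpha1 \<bullet> vec_part alpha1 = 1" "vec_part alpha2 \<bullet> vec_part alpha2 = 1"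
  "vec_part alpha3 \<bullet> vec_part alpha3 = 1"
  "vec_part alpha1 \<bullet> vec_part alpha2 = - cos (pi / 3)"
  "vec_part alpha2 \<bullet> vec_part alpha3 = - cos (pi / 5)"
  "vec_part alpha1 \<bullet> vec_part alpha3 = 0"
  using tau_squared
  by (simp_all add: vec_part_def alpha1_def alpha2_def alpha3_def cl3_defs e1_def e2_def e3_def
      inner_vec_def sum_3 cos_60 cos_pi_div_5 field_simps)

text \<open>The reflection group with simple roots \<open>alpha1, alpha2, alpha3\<close>.\<close>

definition H3 :: "(real^3 \<Rightarrow> real^3) set" where
  "H3 = generate O3 {reflect (\<bullet>) (vec_part alpha1), reflect (\<bullet>) (vec_part alpha2),
                      reflect (\<bullet>) (vec_part alpha3)}"

text \<open>
  The sign makes the action of a product of \<open>k\<close> unit vectors the composition of the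
  corresponding \<open>k\<close> reflections.
\<close>

definition pinor_sign :: "cl3 \<Rightarrow> real" where
  "pinor_sign A = (if cl_even A then 1 else -1)"

definition pinor_action :: "cl3 \<Rightarrow> real^3 \<Rightarrow> real^3" where
  "pinor_action A v = vec_part (pinor_sign A *\<^sub>R (cl_rev A * cl_vec v * A))"

lemma cl_vec_anticommutator:
  "cl_vec a * cl_vec v + cl_vec v * cl_vec a = (2 * (v \<bullet> a)) *\<^sub>R 1"
  by (simp add: cl3_defs cl_vec_def e1_def e2_def e3_def inner_vec_def sum_3)

lemma pinor_action_vec:
  assumes "a \<bullet> a = 1"
  shows "pinor_action (cl_vec a) = reflect (\<bullet>) a"
proof
  fix v
  have "cl_vec a * cl_vec a = (a \<bullet> a) *\<^sub>R 1"
    by (simp add: cl3_defs cl_vec_def e1_def e2_def e3_def inner_vec_def sum_3)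
  then have sq: "cl_vec a * cl_vec a = 1" using assms by simp
  have "a \<noteq> 0" using assms by auto
  then have odd: "\<not> cl_even (cl_vec a)"
    by (simp add: cl_even_def cl_vec_def cl3_defs e1_def e2_def e3_def vec_eq_iff forall_3)
  have "cl_vec a * cl_vec v = (2 * (v \<bullet> a)) *\<^sub>R 1 - cl_vec v * cl_vec a"
    using cl_vec_anticommutator[of a v] by (simp only: eq_diff_eq)
  then have "- (cl_vec a * cl_vec v * cl_vec a) = cl_vec v - (2 * (v \<bullet> a)) *\<^sub>R cl_vec a"
    by (simp add: left_diff_distrib mult.assoc sq)
  also have "\<dots> = cl_vec (reflect (\<bullet>) a v)"
    by (simp add: reflect_def assms cl_vec_def cl3_defs algebra_simps)
  finally show "pinor_action (cl_vec a) v = reflect (\<bullet>) a v"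
    using odd by (simp add: pinor_action_def pinor_sign_def cl_rev_vec)
qed

section \<open>Inner product and reduced inner product on even elements\<close>

text \<open>For even \<open>x\<close>, \<open>y\<close> the element below is a scalar; its value is extracted by \<open>c0\<close>.\<close>

definition cl_inner :: "cl3 \<Rightarrow> cl3 \<Rightarrow> real" where
  "cl_inner x y = c0 ((1 / 2) *\<^sub>R (x * cl_rev y + y * cl_rev x))"

lemma cl_inner_scalar:
  assumes "cl_even x" "cl_even y"
  shows "(1 / 2) *\<^sub>R (x * cl_rev y + y * cl_rev x) = cl_inner x y *\<^sub>R 1"
    and "cl_inner x y = c0 x * c0 y + c23 x * c23 y + c31 x * c31 y + c12 x * c12 y"
  using assms by (simp_all add: cl_inner_def cl_even_def cl_rev_def cl3_defs algebra_simps)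

definition Q_tau :: "real set" where
  "Q_tau = {a + tau * b | a b. a \<in> \<rat> \<and> b \<in> \<rat>}"

definition rat_part :: "real \<Rightarrow> real" where
  "rat_part z = (THE a. a \<in> \<rat> \<and> (\<exists>b\<in>\<rat>. z = a + tau * b))"

definition tau_part :: "real \<Rightarrow> real" where
  "tau_part z = (THE b. b \<in> \<rat> \<and> (\<exists>a\<in>\<rat>. z = a + tau * b))"

definition reduced_inner :: "cl3 \<Rightarrow> cl3 \<Rightarrow> real" where
  "reduced_inner x y = rat_part (cl_inner x y)"

text \<open>The 8-dimensional \<open>\<rat>\<close>-vector space on which the reduced inner product lives.\<close>

definition even_Q_tau :: "cl3 set" where
  "even_Q_tau = {x. cl_even x \<and> c0 x \<in> Q_tau \<and> c23 x \<in> Q_tau \<and> c31 x \<in> Q_tau \<and> c12 x \<in> Q_tau}"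

definition even_coeffs :: "cl3 \<Rightarrow> real^4" where
  "even_coeffs x = vector [c0 x, c23 x, c31 x, c12 x]"

definition even_unit :: "4 \<Rightarrow> cl3" where
  "even_unit i = (let a = axis i 1 :: real^4 in Cl3 (a $ 1) 0 0 0 (a $ 2) (a $ 3) (a $ 4) 0)"

text \<open>
  Extension of scalars from \<open>\<rat>\<close> to \<open>\<real>\<close>: the \<open>\<rat>\<close>-basis consisting of
  \<open>u\<^sub>i = even_unit i\<close> and \<open>tau u\<^sub>i\<close> becomes the standard basis of
  \<open>(real^4) \<times> (real^4)\<close>, and the form is the \<open>\<real>\<close>-bilinear extension of its values on that
  basis.
\<close>

definition scalar_ext :: "cl3 \<Rightarrow> (real^4) \<times> (real^4)" where
  "scalar_ext x = (\<chi> i. rat_part (even_coeffs x $ i), \<chi> i. tau_part (even_coeffs x $ i))"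

definition reduced_form :: "(real^4) \<times> (real^4) \<Rightarrow> (real^4) \<times> (real^4) \<Rightarrow> real" where
  "reduced_form v w = (\<Sum>i\<in>UNIV. \<Sum>j\<in>UNIV.
      fst v $ i * fst w $ j * reduced_inner (even_unit i) (even_unit j)
    + fst v $ i * snd w $ j * reduced_inner (even_unit i) (tau *\<^sub>R even_unit j)
    + snd v $ i * fst w $ j * reduced_inner (tau *\<^sub>R even_unit i) (even_unit j)
    + snd v $ i * snd w $ j * reduced_inner (tau *\<^sub>R even_unit i) (tau *\<^sub>R even_unit j))"

lemma sqrt5_irrational: "sqrt 5 \<notin> \<rat>"
proof
  assume "sqrt 5 \<in> \<rat>"
  then obtain m n :: nat where n: "n \<noteq> 0" and eq: "\<bar>sqrt 5\<bar> = real m / real n"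
    and cop: "coprime m n"
    by (rule Rats_abs_nat_div_natE)
  have "real m = sqrt 5 * real n" using eq n by (simp add: field_simps)
  then have "(real m)\<^sup>2 = (sqrt 5)\<^sup>2 * (real n)\<^sup>2" by (simp only: power_mult_distrib)
  then have "real (m\<^sup>2) = real (5 * n\<^sup>2)" by simp
  then have mn: "m\<^sup>2 = 5 * n\<^sup>2" by (rule of_nat_eq_iff[THEN iffD1])
  have five: "5 dvd k" if "5 dvd k\<^sup>2" for k :: nat
    using prime_dvd_power[OF _ that] by simp
  have m5: "5 dvd m" using five[of m] mn by simp
  then obtain k where "m = 5 * k" ..
  with mn have "n\<^sup>2 = 5 * k\<^sup>2" by (simp add: power2_eq_square)
  then have "5 dvd n" using five[of n] by simp
  with m5 have "5 dvd gcd m n" by (rule gcd_greatest)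
  with cop show False by simp
qed

lemma Q_tau_unique:
  assumes "a \<in> \<rat>" "b \<in> \<rat>" "a' \<in> \<rat>" "b' \<in> \<rat>" "a + tau * b = a' + tau * b'"
  shows "a = a' \<and> b = b'"
proof -
  have "b = b'"
  proof (rule ccontr)
    assume "b \<noteq> b'"
    then have "tau = (a' - a) / (b - b')" using assms(5) by (simp add: field_simps)
    then have "tau \<in> \<rat>" using assms(1-4) by (metis Rats_diff Rats_divide)
    then have "2 * tau - 1 \<in> \<rat>" by (intro Rats_diff Rats_mult) simp_all
    moreover have "2 * tau - 1 = sqrt 5" by (simp add: tau_def field_simps)
    ultimately show False using sqrt5_irrational by simp
  qed
  with assms(5) show ?thesis by simp
qed

lemma rat_part_eq:
  assumes "a \<in> \<rat>" "b \<in> \<rat>" shows "rat_part (a + tau * b) = a"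
  unfolding rat_part_def
proof (rule the_equality)
  show "a \<in> \<rat> \<and> (\<exists>b'\<in>\<rat>. a + tau * b = a + tau * b')" using assms by blast
next
  fix c assume "c \<in> \<rat> \<and> (\<exists>b'\<in>\<rat>. a + tau * b = c + tau * b')"
  then show "c = a" using Q_tau_unique assms by blast
qed

lemma tau_part_eq:
  assumes "a \<in> \<rat>" "b \<in> \<rat>" shows "tau_part (a + tau * b) = b"
  unfolding tau_part_def
proof (rule the_equality)
  show "b \<in> \<rat> \<and> (\<exists>a'\<in>\<rat>. a + tau * b = a' + tau * b)" using assms by blast
next
  fix c assume "c \<in> \<rat> \<and> (\<exists>a'\<in>\<rat>. a + tau * b = a' + tau * c)"
  then show "c = b" using Q_tau_unique assms by blast
qed

lemma Q_tau_parts: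
  assumes "z \<in> Q_tau"
  shows "rat_part z \<in> \<rat>" "tau_part z \<in> \<rat>" "z = rat_part z + tau * tau_part z"
  using assms by (auto simp: Q_tau_def rat_part_eq tau_part_eq)

lemma Q_tauI: "a \<in> \<rat> \<Longrightarrow> b \<in> \<rat> \<Longrightarrow> a + tau * b \<in> Q_tau"
  by (auto simp: Q_tau_def)

lemma Q_tau_add:
  assumes "z \<in> Q_tau" "w \<in> Q_tau"
  shows "z + w \<in> Q_tau" "rat_part (z + w) = rat_part z + rat_part w"
    "tau_part (z + w) = tau_part z + tau_part w"
proof -
  have eq: "z + w = (rat_part z + rat_part w) + tau * (tau_part z + tau_part w)"
    using Q_tau_parts(3)[OF assms(1)] Q_tau_parts(3)[OF assms(2)] by (simp add: algebra_simps)
  have r: "rat_part z + rat_part w \<in> \<rat>" "tau_part z + tau_part w \<in> \<rat>"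
    using Q_tau_parts(1,2)[OF assms(1)] Q_tau_parts(1,2)[OF assms(2)] by simp_all
  show "z + w \<in> Q_tau" using eq r by (auto simp: Q_tau_def)
  show "rat_part (z + w) = rat_part z + rat_part w"
    using rat_part_eq[OF r] eq by simp
  show "tau_part (z + w) = tau_part z + tau_part w"
    using tau_part_eq[OF r] eq by simp
qed

lemma Q_tau_mult:
  assumes "z \<in> Q_tau" "w \<in> Q_tau"
  shows "z * w \<in> Q_tau"
    "rat_part (z * w) = rat_part z * rat_part w + tau_part z * tau_part w"
    "tau_part (z * w) =
       rat_part z * tau_part w + tau_part z * rat_part w + tau_part z * tau_part w"
proof -
  have t: "tau * (tau * x) = x + tau * x" for x
    by (simp add: mult.assoc[symmetric] tau_squared distrib_right)
  have mult: "(a + tau * b) * (c + tau * d) = (a * c + b * d) + tau * (a * d + b * c + b * d)"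
    for a b c d by (simp add: algebra_simps t)
  let ?r = "rat_part z * rat_part w + tau_part z * tau_part w"
  let ?t = "rat_part z * tau_part w + tau_part z * rat_part w + tau_part z * tau_part w"
  have eq: "z * w = ?r + tau * ?t"
    using mult[of "rat_part z" "tau_part z" "rat_part w" "tau_part w"]
      Q_tau_parts(3)[OF assms(1)] Q_tau_parts(3)[OF assms(2)] by simp
  have r: "?r \<in> \<rat>" "?t \<in> \<rat>"
    using Q_tau_parts(1,2)[OF assms(1)] Q_tau_parts(1,2)[OF assms(2)] by simp_all
  show "z * w \<in> Q_tau" using eq r by (auto simp: Q_tau_def)
  show "rat_part (z * w) = ?r" using rat_part_eq[OF r] eq by simp
  show "tau_part (z * w) = ?t" using tau_part_eq[OF r] eq by simp
qed

lemma Q_tau_rat: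
  assumes "q \<in> \<rat>" shows "q \<in> Q_tau" "rat_part q = q" "tau_part q = 0"
  using rat_part_eq[of q 0] tau_part_eq[of q 0] Q_tauI[of q 0] assms by simp_all

lemma Q_tau_tau: "tau \<in> Q_tau" "rat_part tau = 0" "tau_part tau = 1"
  using rat_part_eq[of 0 1] tau_part_eq[of 0 1] Q_tauI[of 0 1] by simp_all

lemma vector_4_nth [simp]:
  "(vector [a, b, c, d] :: 'a::zero^4) $ 1 = a" "(vector [a, b, c, d] :: 'a::zero^4) $ 2 = b"
  "(vector [a, b, c, d] :: 'a::zero^4) $ 3 = c" "(vector [a, b, c, d] :: 'a::zero^4) $ 4 = d"
  unfolding vector_def by simp_all

lemma even_Q_tau_coeff: "x \<in> even_Q_tau \<Longrightarrow> even_coeffs x $ i \<in> Q_tau"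
  using exhaust_4[of i] by (auto simp: even_Q_tau_def even_coeffs_def)

text \<open>\<open>scalar_ext\<close> is \<open>\<rat>\<close>-linear and maps the \<open>\<rat>\<close>-basis to the standard basis.\<close>

lemma scalar_ext_add:
  assumes "x \<in> even_Q_tau" "y \<in> even_Q_tau"
  shows "scalar_ext (x + y) = scalar_ext x + scalar_ext y"
proof -
  have "even_coeffs (x + y) = even_coeffs x + even_coeffs y"
    by (simp add: even_coeffs_def plus_cl3_def vec_eq_iff forall_4)
  then show ?thesis
    using even_Q_tau_coeff[OF assms(1)] even_Q_tau_coeff[OF assms(2)]
    by (simp add: scalar_ext_def vec_eq_iff Q_tau_add)
qed

lemma scalar_ext_scale:
  assumes "q \<in> \<rat>" "x \<in> even_Q_tau"
  shows "scalar_ext (q *\<^sub>R x) = q *\<^sub>R scalar_ext x"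
proof -
  have "even_coeffs (q *\<^sub>R x) = q *\<^sub>R even_coeffs x"
    by (simp add: even_coeffs_def scaleR_cl3_def vec_eq_iff forall_4)
  then show ?thesis
    using even_Q_tau_coeff[OF assms(2)] Q_tau_rat[OF assms(1)]
    by (simp add: scalar_ext_def vec_eq_iff Q_tau_mult)
qed

lemma even_unit_simps:
  "even_unit 1 = Cl3 1 0 0 0 0 0 0 0" "even_unit 2 = Cl3 0 0 0 0 1 0 0 0"
  "even_unit 3 = Cl3 0 0 0 0 0 1 0 0" "even_unit 4 = Cl3 0 0 0 0 0 0 1 0"
  by (simp_all add: even_unit_def axis_def)

lemma even_coeffs_unit: "even_coeffs (r *\<^sub>R even_unit i) = r *\<^sub>R axis i 1"
  using exhaust_4[of i]
  by (elim disjE)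
    (simp_all add: even_coeffs_def even_unit_simps scaleR_cl3_def vec_eq_iff forall_4 axis_def)

lemma scalar_ext_basis:
  "scalar_ext (even_unit i) = (axis i 1, 0)" "scalar_ext (tau *\<^sub>R even_unit i) = (0, axis i 1)"
proof -
  have r: "rat_part 0 = 0" "tau_part 0 = 0" "rat_part 1 = 1" "tau_part 1 = 0"
    by (simp_all add: Q_tau_rat)
  have "even_coeffs (even_unit i) = axis i 1" using even_coeffs_unit[of 1 i] by simp
  then show "scalar_ext (even_unit i) = (axis i 1, 0)"
    by (simp add: scalar_ext_def vec_eq_iff axis_def r)
  show "scalar_ext (tau *\<^sub>R even_unit i) = (0, axis i 1)"
    by (simp add: scalar_ext_def even_coeffs_unit vec_eq_iff axis_def r Q_tau_tau)
qed

lemma even_basis_expansion: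
  assumes "x \<in> even_Q_tau"
  shows "x = (\<Sum>i\<in>UNIV. fst (scalar_ext x) $ i *\<^sub>R even_unit i
                     + snd (scalar_ext x) $ i *\<^sub>R (tau *\<^sub>R even_unit i))"
proof -
  have c: "even_coeffs x $ i = fst (scalar_ext x) $ i + snd (scalar_ext x) $ i * tau" for i
    unfolding scalar_ext_def fst_conv snd_conv vec_lambda_beta mult.commute[of _ tau]
    by (rule Q_tau_parts(3)[OF even_Q_tau_coeff[OF assms]])
  have "x = (\<Sum>i\<in>UNIV. even_coeffs x $ i *\<^sub>R even_unit i)"
    using assms
    by (simp add: sum_4 even_unit_simps cl3_defs cl3_eq_iff even_Q_tau_def cl_even_def
        even_coeffs_def)
  also have "\<dots> = (\<Sum>i\<in>UNIV. fst (scalar_ext x) $ i *\<^sub>R even_unit i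
                     + snd (scalar_ext x) $ i *\<^sub>R (tau *\<^sub>R even_unit i))"
    by (simp only: c scaleR_add_left scaleR_scaleR)
  finally show ?thesis .
qed

lemma inj_on_scalar_ext: "inj_on scalar_ext even_Q_tau"
proof (rule inj_onI)
  fix x y assume xy: "x \<in> even_Q_tau" "y \<in> even_Q_tau" and eq: "scalar_ext x = scalar_ext y"
  show "x = y"
    by (subst even_basis_expansion[OF xy(1)], subst even_basis_expansion[OF xy(2)])
      (simp only: eq)
qed

text \<open>The real form restricts to the reduced inner product.\<close>

lemma reduced_form_scalar_ext:
  assumes "x \<in> even_Q_tau" "y \<in> even_Q_tau"
  shows "reduced_form (scalar_ext x) (scalar_ext y) = reduced_inner x y"
proof -
  have ev: "cl_even (r *\<^sub>R even_unit i)" for r i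
    by (simp add: cl_even_def even_unit_def scaleR_cl3_def Let_def)
  have inner: "cl_inner x y = even_coeffs x \<bullet> even_coeffs y"
    if "cl_even x" "cl_even y" for x y
    using that by (simp add: cl_inner_scalar(2) inner_vec_def sum_4 even_coeffs_def)
  have *: "cl_inner (r *\<^sub>R even_unit i) (s *\<^sub>R even_unit j) = (if i = j then r * s else 0)" for r s i j
    unfolding inner[OF ev ev] even_coeffs_unit
    by (simp add: inner_axis_axis)
  have **: "reduced_inner (r *\<^sub>R even_unit i) (s *\<^sub>R even_unit j)
      = (if i = j then rat_part (r * s) else 0)" for r s i j
    by (simp add: reduced_inner_def * Q_tau_rat)
  have tt: "rat_part (tau * tau) = 1"
    by (simp add: Q_tau_mult Q_tau_tau)
  have basis:
    "reduced_inner (even_unit i) (even_unit j) = (if i = j then 1 else 0)"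
    "reduced_inner (even_unit i) (tau *\<^sub>R even_unit j) = 0"
    "reduced_inner (tau *\<^sub>R even_unit i) (even_unit j) = 0"
    "reduced_inner (tau *\<^sub>R even_unit i) (tau *\<^sub>R even_unit j) = (if i = j then 1 else 0)" for i j
    using **[of 1 i 1 j] **[of 1 i tau j] **[of tau i 1 j] **[of tau i tau j]
    by (simp_all add: Q_tau_rat Q_tau_tau tt)
  have form: "reduced_form v w = (\<Sum>i\<in>UNIV. fst v $ i * fst w $ i + snd v $ i * snd w $ i)" for v w
    by (simp add: reduced_form_def basis sum.distrib if_distrib cong: if_cong)
  have evxy: "cl_even x" "cl_even y" using assms by (simp_all add: even_Q_tau_def)
  note q = even_Q_tau_coeff[OF assms(1)] even_Q_tau_coeff[OF assms(2)]
  show ?thesis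
    by (simp add: reduced_inner_def inner[OF evxy] inner_vec_def form sum_4 Q_tau_add Q_tau_mult q scalar_ext_def)
qed

section \<open>Root systems\<close>

definition symmetric_positive_definite :: "('v::real_vector \<Rightarrow> 'v \<Rightarrow> real) \<Rightarrow> bool" where
  "symmetric_positive_definite B \<longleftrightarrow>
     (\<forall>v. linear (B v)) \<and> (\<forall>v w. B v w = B w v) \<and> (\<forall>v. v \<noteq> 0 \<longrightarrow> B v v > 0)"

definition root_system :: "('v::real_vector \<Rightarrow> 'v \<Rightarrow> real) \<Rightarrow> 'v set \<Rightarrow> bool" where
  "root_system B \<Phi> \<longleftrightarrow>
     symmetric_positive_definite B \<and> 0 \<notin> \<Phi> \<and> span \<Phi> = UNIV \<and>
     (\<forall>\<alpha>\<in>\<Phi>. \<Phi> \<inter> range (\<lambda>c. c *\<^sub>R \<alpha>) = {\<alpha>, - \<alpha>}) \<and>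
     (\<forall>\<alpha>\<in>\<Phi>. reflect B \<alpha> ` \<Phi> = \<Phi>)"

definition base_of :: "'v::real_vector set \<Rightarrow> 'v set \<Rightarrow> bool" where
  "base_of \<Delta> \<Phi> \<longleftrightarrow> finite \<Delta> \<and> \<Delta> \<subseteq> \<Phi> \<and> independent \<Delta> \<and>
     (\<forall>\<alpha>\<in>\<Phi>. \<exists>c :: 'v \<Rightarrow> nat.
        \<alpha> = (\<Sum>\<delta>\<in>\<Delta>. real (c \<delta>) *\<^sub>R \<delta>) \<or> \<alpha> = - (\<Sum>\<delta>\<in>\<Delta>. real (c \<delta>) *\<^sub>R \<delta>))"

text \<open>A finite crystallographic root system whose simple roots have Cartan matrix \<open>C\<close>.\<close>

definition root_system_of_type ::
  "('v::real_vector \<Rightarrow> 'v \<Rightarrow> real) \<Rightarrow> 'v set \<Rightarrow> nat \<Rightarrow> (nat \<Rightarrow> nat \<Rightarrow> int) \<Rightarrow> bool" where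
  "root_system_of_type B \<Phi> n C \<longleftrightarrow>
     finite \<Phi> \<and> root_system B \<Phi> \<and>
     (\<forall>\<alpha>\<in>\<Phi>. \<forall>\<beta>\<in>\<Phi>. 2 * B \<alpha> \<beta> / B \<beta> \<beta> \<in> \<int>) \<and>
     (\<exists>\<beta>. inj_on \<beta> {1..n} \<and> base_of (\<beta> ` {1..n}) \<Phi> \<and>
        (\<forall>i\<in>{1..n}. \<forall>j\<in>{1..n}. 2 * B (\<beta> i) (\<beta> j) / B (\<beta> j) (\<beta> j) = of_int (C i j)))"

text \<open>Bourbaki numbering: the chain 1-3-4-5-6-7-8 with 2 attached to 4.\<close>

definition cartan_E8 :: "nat \<Rightarrow> nat \<Rightarrow> int" where
  "cartan_E8 i j =
     (if i = j then 2
      else if {i, j} \<in> {{1, 3}, {3, 4}, {2, 4}, {4, 5}, {5, 6}, {6, 7}, {7, 8}} then -1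
      else 0)"

section \<open>The set of \<open>240\<close> vectors\<close>

definition Phi :: "cl3 set" where
  "Phi = {R. R \<in> spinors} \<union> {tau *\<^sub>R (cl_I * Q) | Q. Q \<in> (\<lambda>R. cl_I * R) ` spinors}"

end

theory Submission
  imports Defs
begin

text \<open>
  The even part of \<open>Cl(3)\<close> is the algebra of quaternions. Multiplying the simple roots of
  \<open>H3\<close> by the central element \<open>cl_I\<close> turns them into unit quaternions which generate the
  binary icosahedral group \<open>G\<close> of order 120. The Coxeter element of \<open>H3\<close> shows that \<open>cl_I\<close>
  itself is a pinor (\<open>cl_I_pinors\<close>), so the pinors are exactly \<open>G \<union> cl_I G\<close> and the spinors
  are \<open>G\<close> (\<open>spinors_eq\<close>). A pinor that acts trivially is \<open>\<plusminus>1\<close>, hence two pinors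
  act alike only if they agree up to sign (\<open>pinor_action_eq_iff\<close>), and \<open>H3\<close> has half as many
  elements as the pinor group.

  The group \<open>G\<close> is enumerated in integer coordinates. As a set of vectors, \<open>G\<close> is the root
  system \<open>H4\<close>; over its four simple roots the icosians are the lattice \<open>\<int>[tau]\<^sup>4\<close>, and left
  multiplication by a generator is an integer 8 by 8 matrix. Computing with these matrices
  gives the order of \<open>G\<close>, the signs of the coordinates of its elements and the list of their
  real parts.

  Since \<open>cl_I\<^sup>2 = -1\<close>, the set \<open>Phi\<close> is \<open>G \<union> tau G\<close>. It is invariant under right
  multiplication by \<open>G\<close>, which preserves the inner product; so invariance under reflections
  only has to be verified for the two roots 1 and \<open>tau\<close> (\<open>Phi_step\<close>). There it follows from
  the list of real parts and the equation \<open>k\<^sup>2 = 2 Re(k) k - 1\<close>: each reflected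
  element is, up to sign and a factor \<open>tau\<close>, a power of \<open>k\<close> (\<open>root_step_spinor\<close>).

  The simple roots of \<open>H4\<close> and their \<open>tau\<close>-multiples form a base of type \<open>E8\<close>: the reduced
  inner products are those of the \<open>E8\<close> diagram (\<open>e8_gram\<close>), and a root of \<open>H4\<close> has coefficients
  \<open>p + tau q\<close> over the simple roots with all \<open>p, q\<close> of the same sign, a property that
  multiplication by \<open>tau\<close> preserves (\<open>base_of_e8\<close>).
\<close>

section \<open>Versors\<close>

lemma tau_simps: "tau * tau = tau + 1" "tau * (tau * x) = tau * x + x"
  by (simp_all add: tau_squared mult.assoc[symmetric] distrib_right)

lemma cl_I_eq: "cl_I = Cl3 0 0 0 0 0 0 0 1"
  by (simp add: cl_I_def e1_def e2_def e3_def times_cl3_def)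

lemma cl_I_central: "x * cl_I = cl_I * x"
  by (simp add: cl_I_eq times_cl3_def)

lemma cl_I_left_commute: "x * (cl_I * y) = cl_I * (x * y)"
  by (simp only: cl_I_central flip: mult.assoc)

lemma cl_I_square: "cl_I * cl_I = - 1" "cl_I * (cl_I * x) = - x"
  by (simp_all add: cl_I_eq times_cl3_def one_cl3_def uminus_cl3_def zero_cl3_def cl3_eq_iff)

definition cl_odd :: "cl3 \<Rightarrow> bool" where
  "cl_odd x \<longleftrightarrow> c0 x = 0 \<and> c23 x = 0 \<and> c31 x = 0 \<and> c12 x = 0"

lemma parity_mult:
  "cl_even x \<Longrightarrow> cl_even y \<Longrightarrow> cl_even (x * y)"
  "cl_odd x \<Longrightarrow> cl_odd y \<Longrightarrow> cl_even (x * y)"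
  "cl_even x \<Longrightarrow> cl_odd y \<Longrightarrow> cl_odd (x * y)"
  "cl_odd x \<Longrightarrow> cl_even y \<Longrightarrow> cl_odd (x * y)"
  by (simp_all add: cl_even_def cl_odd_def times_cl3_def)

lemma cl_odd_cl_I_mult: "cl_even x \<Longrightarrow> cl_odd (cl_I * x)"
  by (simp add: cl_even_def cl_odd_def cl_I_eq times_cl3_def)

lemma even_odd_zero: "cl_even x \<Longrightarrow> cl_odd x \<Longrightarrow> x = 0"
  by (simp add: cl_even_def cl_odd_def cl3_eq_iff zero_cl3_def)

lemma cl_rev_rev [simp]: "cl_rev (cl_rev x) = x"
  by (simp add: cl_rev_def)

lemma cl_rev_parity:
  "cl_even (cl_rev x) \<longleftrightarrow> cl_even x" "cl_odd (cl_rev x) \<longleftrightarrow> cl_odd x"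
  by (simp_all add: cl_even_def cl_odd_def cl_rev_def)

lemma one_even_rev [simp]: "cl_even 1" "cl_rev 1 = 1"
  by (simp_all add: cl_even_def cl_rev_def one_cl3_def)

lemma cl_even_minus [simp]: "cl_even (- x) \<longleftrightarrow> cl_even x"
  by (simp add: cl_even_def uminus_cl3_def)

text \<open>
  The two properties of a product of unit vectors that give it an orthogonal action on
  vectors: it is homogeneous, and reversal inverts it.
\<close>

definition versor :: "cl3 \<Rightarrow> bool" where
  "versor A \<longleftrightarrow> cl_rev A * A = 1 \<and> A * cl_rev A = 1 \<and> (cl_even A \<or> cl_odd A)"

lemma versor_mult:
  assumes "versor A" "versor B"
  shows "versor (A * B)"
proof -
  have "cl_rev (A * B) * (A * B) = cl_rev B * (cl_rev A * A) * B"
    "A * B * cl_rev (A * B) = A * (B * cl_rev B) * cl_rev A"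
    by (simp_all add: cl_rev_mult mult.assoc)
  then show ?thesis using assms parity_mult unfolding versor_def by auto
qed

lemma versor_rev: "versor A \<Longrightarrow> versor (cl_rev A)"
  by (auto simp: versor_def cl_rev_parity)

lemma versor_nonzero: "versor A \<Longrightarrow> A \<noteq> 0"
  by (auto simp: versor_def)

lemma versor_odd_iff: "versor A \<Longrightarrow> cl_odd A \<longleftrightarrow> \<not> cl_even A"
  using even_odd_zero versor_nonzero by (auto simp: versor_def)

lemma pinor_sign_mult:
  assumes "versor A" "versor B"
  shows "pinor_sign (A * B) = pinor_sign A * pinor_sign B"
  using assms versor_odd_iff[OF assms(1)] versor_odd_iff[OF assms(2)]
    versor_odd_iff[OF versor_mult[OF assms]] parity_mult[of A B]
  by (auto simp: pinor_sign_def)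

text \<open>
  The element \<open>w = A\<^sup>~ v A\<close> is odd because \<open>A\<close> is homogeneous, and it is its own reverse.
  Reversal negates \<open>cl_I\<close>, so \<open>w\<close> has no \<open>cl_I\<close> component and is a vector.
\<close>

lemma cl_vec_pinor_action:
  assumes "versor A"
  shows "cl_vec (pinor_action A v) = pinor_sign A *\<^sub>R (cl_rev A * cl_vec v * A)"
proof -
  define w where "w = cl_rev A * cl_vec v * A"
  have v: "cl_odd (cl_vec v)"
    by (simp add: cl_odd_def cl_vec_def cl3_defs e1_def e2_def e3_def)
  have "cl_odd w"
    using assms parity_mult v cl_rev_parity unfolding w_def versor_def by metis
  moreover have "cl_rev w = w"
    by (simp add: w_def cl_rev_mult cl_rev_vec mult.assoc)
  then have "c123 w = 0" by (simp add: cl_rev_def cl3_eq_iff)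
  ultimately have "cl_vec (vec_part (s *\<^sub>R w)) = s *\<^sub>R w" for s
    by (simp add: cl_odd_def cl_vec_def vec_part_def cl3_eq_iff cl3_defs e1_def e2_def e3_def)
  then show ?thesis by (simp add: pinor_action_def w_def)
qed

lemma pinor_action_mult:
  assumes "versor A" "versor B"
  shows "pinor_action (A * B) = pinor_action B \<circ> pinor_action A"
proof
  fix v
  have "cl_vec (pinor_action (A * B) v)
      = (pinor_sign A * pinor_sign B) *\<^sub>R (cl_rev B * (cl_rev A * cl_vec v * A) * B)"
    by (simp add: cl_vec_pinor_action[OF versor_mult[OF assms]] pinor_sign_mult[OF assms]
        cl_rev_mult mult.assoc)
  also have "\<dots> = cl_vec (pinor_action B (pinor_action A v))"
    by (simp add: cl_vec_pinor_action assms)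
  finally show "pinor_action (A * B) v = (pinor_action B \<circ> pinor_action A) v"
    by (metis comp_apply vec_part_cl_vec)
qed

text \<open>
  A versor acting trivially commutes (if even) or anticommutes (if odd) with every
  vector. An even element commuting with all vectors is a scalar; an odd one anticommuting
  with all vectors is 0, because \<open>cl_I\<close> is central and no non-zero vector is orthogonal to
  all of \<open>e1\<close>, \<open>e2\<close>, \<open>e3\<close>.
\<close>

lemma pinor_action_eq_id:
  assumes "versor C" "pinor_action C = id"
  shows "C = 1 \<or> C = - 1"
proof -
  have *: "cl_vec v = pinor_sign C *\<^sub>R (cl_rev C * cl_vec v * C)" for v
    using cl_vec_pinor_action[OF assms(1), of v] assms(2) by simp
  have comm: "C * cl_vec v = pinor_sign C *\<^sub>R (cl_vec v * C)" for v
  proof -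
    have "C * cl_vec v = pinor_sign C *\<^sub>R (C * cl_rev C * cl_vec v * C)"
      by (subst *) (simp add: mult.assoc)
    then show ?thesis using assms(1) by (simp add: versor_def)
  qed
  have e: "cl_vec (axis 1 1) = e1" "cl_vec (axis 2 1) = e2" "cl_vec (axis 3 1) = e3"
    by (simp_all add: cl_vec_def axis_def)
  note comms = comm[of "axis 1 1"] comm[of "axis 2 1"] comm[of "axis 3 1"]
  show ?thesis
  proof (cases "cl_even C")
    case True
    then have C: "C = c0 C *\<^sub>R 1"
      using comms
      by (simp add: e pinor_sign_def cl_even_def cl3_eq_iff cl3_defs e1_def e2_def e3_def)
    then have "(c0 C *\<^sub>R 1 :: cl3) * c0 C *\<^sub>R 1 = 1"
      using assms(1) True by (simp add: versor_def cl_rev_def cl_even_def cl3_eq_iff cl3_defs)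
    then have "c0 C * c0 C = 1" by (simp add: cl3_eq_iff cl3_defs)
    then have "c0 C = 1 \<or> c0 C = - 1" by (simp add: square_eq_1_iff)
    then show ?thesis using C by auto
  next
    case False
    then have "cl_odd C" using versor_odd_iff assms(1) by simp
    then have "C = 0"
      using comms False
      by (simp add: e pinor_sign_def cl_odd_def cl3_eq_iff cl3_defs e1_def e2_def e3_def)
    then show ?thesis using versor_nonzero assms(1) by simp
  qed
qed

lemma pinor_action_minus: "pinor_action (- A) = pinor_action A"
proof
  fix v
  have "cl_rev (- A) = - cl_rev A" by (simp add: cl_rev_def uminus_cl3_def)
  then show "pinor_action (- A) v = pinor_action A v" by (simp add: pinor_action_def pinor_sign_def)
qed

lemma pinor_action_one: "pinor_action 1 = id"
  by (rule ext) (simp add: pinor_action_def pinor_sign_def)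

lemma pinor_action_eq_iff:
  assumes "versor A" "versor B"
  shows "pinor_action B = pinor_action A \<longleftrightarrow> B = A \<or> B = - A"
proof
  assume eq: "pinor_action B = pinor_action A"
  have "pinor_action (B * cl_rev A) = pinor_action (A * cl_rev A)"
    using assms by (simp add: pinor_action_mult versor_rev eq)
  then have "pinor_action (B * cl_rev A) = id"
    using assms by (simp add: versor_def pinor_action_one)
  then have "B * cl_rev A = 1 \<or> B * cl_rev A = - 1"
    using assms by (intro pinor_action_eq_id versor_mult versor_rev)
  moreover have "B = B * cl_rev A * A"
    using assms by (simp add: versor_def mult.assoc)
  ultimately show "B = A \<or> B = - A" by auto
qed (auto simp: pinor_action_minus)

section \<open>The pinor group and the reflection group\<close>

lemma group_cl3_units: "group cl3_units"
  by (rule monoid.units_group[OF cl3_monoid])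

lemma cl3_units_simps [simp]: "x \<otimes>\<^bsub>cl3_units\<^esub> y = x * y" "\<one>\<^bsub>cl3_units\<^esub> = 1"
  by (simp_all add: units_of_def cl3_monoid_def)

lemma cl3_units_inv:
  assumes "x * y = 1" "y * x = 1"
  shows "x \<in> carrier cl3_units" "inv\<^bsub>cl3_units\<^esub> x = y"
proof -
  have *: "x \<in> carrier cl3_units" "y \<in> carrier cl3_units"
    using assms by (auto simp: units_of_def Units_def cl3_monoid_def)
  then show "x \<in> carrier cl3_units" "inv\<^bsub>cl3_units\<^esub> x = y"
    using group.inv_equality[OF group_cl3_units, of y x] assms by simp_all
qed

lemma pinors_one: "1 \<in> pinors"
  using generate.one[of cl3_units] by (simp add: pinors_def)

lemma pinors_mult: "A \<in> pinors \<Longrightarrow> B \<in> pinors \<Longrightarrow> A * B \<in> pinors"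
  using generate.eng[of _ cl3_units] by (simp add: pinors_def)

lemma alpha_pinors: "alpha1 \<in> pinors" "alpha2 \<in> pinors" "alpha3 \<in> pinors"
  by (auto simp: pinors_def intro: generate.incl)

text \<open>The generators are involutions, so the rule needs no case for inverses.\<close>

lemma pinors_induct [consumes 1, case_names one gen mult]:
  assumes "A \<in> pinors"
    and "P 1" "\<And>a. a \<in> {alpha1, alpha2, alpha3} \<Longrightarrow> P a"
    and "\<And>A B. A \<in> pinors \<Longrightarrow> B \<in> pinors \<Longrightarrow> P A \<Longrightarrow> P B \<Longrightarrow> P (A * B)"
  shows "P A"
  using assms(1) unfolding pinors_def
proof (induction rule: generate.induct)
  case (inv h)
  then have "h * h = 1" using alpha_square by auto
  then show ?case using inv assms(3) by (simp add: cl3_units_inv)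
next
  case (eng h1 h2)
  then show ?case using assms(4)[of h1 h2] by (simp add: pinors_def)
qed (use assms in simp_all)

lemma alpha_components:
  "alpha1 = Cl3 0 0 1 0 0 0 0 0" "alpha2 = Cl3 0 ((1 - tau) / 2) (- 1 / 2) (- tau / 2) 0 0 0 0"
  "alpha3 = Cl3 0 0 0 1 0 0 0 0"
  by (simp_all add: alpha1_def alpha2_def alpha3_def cl3_defs e1_def e2_def e3_def field_simps)

lemma pinors_versor: "A \<in> pinors \<Longrightarrow> versor A"
proof (induction rule: pinors_induct)
  case one
  show ?case by (simp add: versor_def)
next
  case (gen a)
  then have "cl_rev a = a" "cl_odd a" "a * a = 1"
    using alpha_square by (auto simp: alpha_components cl_rev_def cl_odd_def)
  then show ?case by (simp add: versor_def)
qed (rule versor_mult)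

lemma pinors_rev: "A \<in> pinors \<Longrightarrow> cl_rev A \<in> pinors"
proof (induction rule: pinors_induct)
  case one
  show ?case using pinors_one by simp
next
  case (gen a)
  then have "cl_rev a = a" by (auto simp: alpha_components cl_rev_def)
  then show ?case using gen alpha_pinors by auto
qed (simp add: cl_rev_mult pinors_mult)

lemma spinors_subgroup: "subgroup spinors cl3_units"
proof (rule group.subgroupI[OF group_cl3_units])
  have inv: "inv\<^bsub>cl3_units\<^esub> A = cl_rev A" "A \<in> carrier cl3_units" if "A \<in> pinors" for A
    using pinors_versor[OF that] cl3_units_inv[of A "cl_rev A"] by (simp_all add: versor_def)
  show "spinors \<subseteq> carrier cl3_units" by (auto simp: spinors_def inv)
  have "1 \<in> spinors" by (simp add: spinors_def pinors_one)
  then show "spinors \<noteq> {}" by blast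
  show "inv\<^bsub>cl3_units\<^esub> A \<in> spinors" if "A \<in> spinors" for A
    using that by (simp add: spinors_def inv cl_rev_parity pinors_rev)
qed (simp add: spinors_def pinors_mult parity_mult)

text \<open>
  The action reverses products, so both inclusions are inductions over generated
  subgroups, matching each simple reflection with the simple root that acts as it.
\<close>

lemma pinor_action_image: "pinor_action ` pinors = H3"
proof -
  let ?R = "{reflect (\<bullet>) (vec_part alpha1), reflect (\<bullet>) (vec_part alpha2),
             reflect (\<bullet>) (vec_part alpha3)}"
  have act: "pinor_action alpha1 = reflect (\<bullet>) (vec_part alpha1)"
    "pinor_action alpha2 = reflect (\<bullet>) (vec_part alpha2)"
    "pinor_action alpha3 = reflect (\<bullet>) (vec_part alpha3)"
  proof -
    have "cl_vec (vec_part alpha1) = alpha1" "cl_vec (vec_part alpha2) = alpha2"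
      "cl_vec (vec_part alpha3) = alpha3"
      by (simp_all add: cl_vec_def vec_part_def alpha_components cl3_defs e1_def e2_def e3_def)
    then show "pinor_action alpha1 = reflect (\<bullet>) (vec_part alpha1)"
      "pinor_action alpha2 = reflect (\<bullet>) (vec_part alpha2)"
      "pinor_action alpha3 = reflect (\<bullet>) (vec_part alpha3)"
      using pinor_action_vec H3_simple_roots(1-3) by metis+
  qed
  have O3_simps: "f \<otimes>\<^bsub>O3\<^esub> g = f \<circ> g" "\<one>\<^bsub>O3\<^esub> = id" for f g
    by (simp_all add: O3_def)
  have "pinor_action A \<in> H3" if "A \<in> pinors" for A
    using that
  proof (induction rule: pinors_induct)
    case one
    show ?case unfolding H3_def pinor_action_one O3_simps(2)[symmetric] by (rule generate.one)
  next
    case (gen a)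
    then show ?case unfolding H3_def by (auto simp: act intro: generate.incl)
  next
    case (mult A B)
    then have "pinor_action B \<otimes>\<^bsub>O3\<^esub> pinor_action A \<in> H3"
      unfolding H3_def by (intro generate.eng)
    then show ?case using mult by (simp only: O3_simps pinor_action_mult pinors_versor)
  qed
  moreover have "f \<in> pinor_action ` pinors" if "f \<in> H3" for f
    using that unfolding H3_def
  proof (induction rule: generate.induct)
    case one
    show ?case using pinors_one pinor_action_one O3_simps(2) by (metis imageI)
  next
    case (incl f)
    then show ?case using act alpha_pinors by (metis image_eqI insertE singletonD)
  next
    case (inv f)
    then have "f \<in> pinor_action ` {alpha1, alpha2, alpha3}" by (simp add: act)
    then obtain a where a: "a \<in> {alpha1, alpha2, alpha3}" "f = pinor_action a" by blast
    have "a \<in> pinors" "a * a = 1" using a alpha_pinors alpha_square by auto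
    then have "f \<circ> f = id"
      using pinor_action_mult[of a a] a pinors_versor pinor_action_one by simp
    moreover have "f \<in> carrier O3"
    proof -
      have "x \<noteq> 0" if "x \<bullet> x = 1" for x :: "real^3" using that by auto
      then show ?thesis using inv reflect_in_O3 H3_simple_roots(1-3) by auto
    qed
    ultimately have "inv\<^bsub>O3\<^esub> f = f"
      by (intro group.inv_equality[OF group_O3]) (simp_all add: O3_simps)
    then show ?case using a \<open>a \<in> pinors\<close> by simp
  next
    case (eng f g)
    then obtain A B where "A \<in> pinors" "B \<in> pinors" "f = pinor_action A" "g = pinor_action B"
      by blast
    then have "f \<otimes>\<^bsub>O3\<^esub> g = pinor_action (B * A)" "B * A \<in> pinors"
      by (simp_all add: O3_simps pinor_action_mult pinors_versor pinors_mult)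
    then show ?case by blast
  qed
  ultimately show ?thesis by blast
qed

section \<open>The icosians\<close>

text \<open>
  Multiplying the simple roots of \<open>H3\<close> by \<open>cl_I\<close> gives three unit bivectors with the same
  Gram matrix. The element \<open>h4_root1\<close> is orthogonal to the last two and has inner product
  -1/2 with the first, which extends the Coxeter diagram to that of \<open>H4\<close>. These four
  elements are a basis over \<open>\<int>[tau]\<close> of the ring of icosians. The coordinate \<open>c0\<close> vanishes on
  the three bivectors, so the \<open>h4_root1\<close>-coefficient of an icosian determines its real part.
\<close>

definition h4_root1 :: cl3 where "h4_root1 = Cl3 ((tau - 1) / 2) 0 0 0 (tau / 2) (- 1 / 2) 0 0"
definition h4_root2 :: cl3 where "h4_root2 = cl_I * alpha1"
definition h4_root3 :: cl3 where "h4_root3 = cl_I * alpha2"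
definition h4_root4 :: cl3 where "h4_root4 = cl_I * alpha3"

lemma h4_root_components:
  "h4_root2 = Cl3 0 0 0 0 0 1 0 0" "h4_root4 = Cl3 0 0 0 0 0 0 1 0"
  "h4_root3 = Cl3 0 0 0 0 ((1 - tau) / 2) (- 1 / 2) (- tau / 2) 0"
  by (simp_all add: h4_root2_def h4_root3_def h4_root4_def alpha_components cl_I_eq times_cl3_def)

text \<open>
  Coordinates over \<open>\<int>[tau]\<close> with respect to the simple roots of \<open>H4\<close>: the arguments are
  \<open>p1, q1, \<dots>, p4, q4\<close>, the i-th coefficient being \<open>pi + tau qi\<close>.
\<close>

datatype zt4 = Zt4 int int int int int int int int

definition ztau :: "int \<Rightarrow> int \<Rightarrow> real" where "ztau p q = of_int p + tau * of_int q"

fun icosian :: "zt4 \<Rightarrow> cl3" where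
  "icosian (Zt4 p1 q1 p2 q2 p3 q3 p4 q4) =
     ztau p1 q1 *\<^sub>R h4_root1 + ztau p2 q2 *\<^sub>R h4_root2 + ztau p3 q3 *\<^sub>R h4_root3 + ztau p4 q4 *\<^sub>R h4_root4"

lemma icosian_components:
  "icosian (Zt4 p1 q1 p2 q2 p3 q3 p4 q4) =
     Cl3 (ztau p1 q1 * (tau - 1) / 2) 0 0 0 ((ztau p1 q1 * tau + ztau p3 q3 * (1 - tau)) / 2)
       (ztau p2 q2 - (ztau p1 q1 + ztau p3 q3) / 2) (ztau p4 q4 - ztau p3 q3 * tau / 2) 0"
  by (simp add: h4_root1_def h4_root_components cl3_defs field_simps)

declare icosian.simps [simp del]

text \<open>
  Left multiplication by each of the three bivectors preserves the ring of icosians, so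
  it acts on the eight integer coordinates by an integer matrix. This reduces the
  enumeration of the group to exact integer arithmetic. The matrices come from expanding
  the twelve products of a bivector and a basis element with \<open>tau\<^sup>2 = tau + 1\<close>.
\<close>

fun mul_h4_root2 :: "zt4 \<Rightarrow> zt4" where
  "mul_h4_root2 (Zt4 p1 q1 p2 q2 p3 q3 p4 q4) = Zt4
    (q1 - 2 * q2 + q3) (p1 + q1 - 2 * p2 - 2 * q2 + p3 + q3)
    (2 * q1 - p2 - 3 * q2 + q3 + q4) (2 * p1 + 2 * q1 - 3 * p2 - 4 * q2 + p3 + q3 + p4 + q4)
    (p1 + 2 * q1 - 2 * p2 - 4 * q2 + q3 + 2 * q4) (2 * p1 + 3 * q1 - 4 * p2 - 6 * q2 + p3 + q3 + 2 * p4 + 2 * q4)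
    (p1 + 2 * q1 - 2 * p2 - 3 * q2 + p3 + p4 + q4) (2 * p1 + 3 * q1 - 3 * p2 - 5 * q2 + q3 + p4 + 2 * q4)"

fun mul_h4_root3 :: "zt4 \<Rightarrow> zt4" where
  "mul_h4_root3 (Zt4 p1 q1 p2 q2 p3 q3 p4 q4) = Zt4
    (q2 - 2 * q3 + p4 + q4) (p2 + q2 - 2 * p3 - 2 * q3 + p4 + 2 * q4)
    (p2 + 2 * q2 - p3 - 3 * q3 + 2 * p4 + q4) (2 * p2 + 3 * q2 - 3 * p3 - 4 * q3 + p4 + 3 * q4)
    (- p1 + 2 * p2 + 3 * q2 - 2 * p3 - 4 * q3 + 2 * p4 + 2 * q4) (- q1 + 3 * p2 + 5 * q2 - 4 * p3 - 6 * q3 + 2 * p4 + 4 * q4)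
    (- q1 + p2 + 3 * q2 - 2 * p3 - 3 * q3 + p4 + 2 * q4) (- p1 - q1 + 3 * p2 + 4 * q2 - 3 * p3 - 5 * q3 + 2 * p4 + 3 * q4)"

fun mul_h4_root4 :: "zt4 \<Rightarrow> zt4" where
  "mul_h4_root4 (Zt4 p1 q1 p2 q2 p3 q3 p4 q4) = Zt4
    (p3 + q3 - 2 * q4) (p3 + 2 * q3 - 2 * p4 - 2 * q4)
    (- q2 + p3 + 3 * q3 - p4 - 3 * q4) (- p2 - q2 + 3 * p3 + 4 * q3 - 3 * p4 - 4 * q4)
    (q1 - 2 * q2 + 2 * p3 + 4 * q3 - 2 * p4 - 4 * q4) (p1 + q1 - 2 * p2 - 2 * q2 + 4 * p3 + 6 * q3 - 4 * p4 - 6 * q4)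
    (q1 - p2 - q2 + 2 * p3 + 3 * q3 - 2 * p4 - 3 * q4) (p1 + q1 - p2 - 2 * q2 + 3 * p3 + 5 * q3 - 3 * p4 - 5 * q4)"

lemma h4_root_mult_icosian:
  "h4_root2 * icosian v = icosian (mul_h4_root2 v)"
  "h4_root3 * icosian v = icosian (mul_h4_root3 v)"
  "h4_root4 * icosian v = icosian (mul_h4_root4 v)"
  by (cases v; simp add: icosian_components h4_root_components times_cl3_def ztau_def field_simps tau_simps)+

lemma ztau_eq_iff: "ztau p q = ztau p' q' \<longleftrightarrow> p = p' \<and> q = q'"
  using Q_tau_unique[of "of_int p" "of_int q" "of_int p'" "of_int q'"] by (auto simp: ztau_def)

lemma inj_icosian: "inj icosian"
proof (rule injI)
  fix v w assume eq: "icosian v = icosian w"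
  have tau: "tau \<noteq> 1" by (simp add: tau_def)
  obtain p1 q1 p2 q2 p3 q3 p4 q4 where v: "v = Zt4 p1 q1 p2 q2 p3 q3 p4 q4" by (cases v)
  obtain p1' q1' p2' q2' p3' q3' p4' q4' where w: "w = Zt4 p1' q1' p2' q2' p3' q3' p4' q4'"
    by (cases w)
  note eq' = eq[unfolded v w icosian_components cl3.inject]
  have x1: "ztau p1 q1 = ztau p1' q1'" using eq' tau by simp
  then have x3: "ztau p3 q3 = ztau p3' q3'" using eq' tau by simp
  then have "ztau p2 q2 = ztau p2' q2'" "ztau p4 q4 = ztau p4' q4'" using x1 eq' by simp_all
  then show "v = w" using x1 x3 by (simp add: v w ztau_eq_iff)
qed

text \<open>
  For left multiplication \<open>f\<close> by a group element this forms the product of a cyclic set of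
  powers with a list, so that a group can be enumerated as a product of such sets.
\<close>

fun sweep :: "nat \<Rightarrow> ('a \<Rightarrow> 'a) \<Rightarrow> 'a list \<Rightarrow> 'a list" where
  "sweep 0 f xs = []"
| "sweep (Suc n) f xs = xs @ sweep n f (map f xs)"

lemma sweep_invariant:
  assumes "\<And>x. P x \<Longrightarrow> P (f x)" "\<forall>x\<in>set xs. P x"
  shows "\<forall>x\<in>set (sweep n f xs). P x"
  using assms(2)
proof (induction n arbitrary: xs)
  case (Suc n)
  then have "\<forall>x\<in>set (sweep n f (map f xs)). P x" using assms(1) by (intro Suc.IH) simp
  then show ?case using Suc.prems by auto
qed simp

text \<open>
  With \<open>b2, b3, b4\<close> for the three bivectors, these are the coordinates of
  \<open>(b2 b3 b4)\<^sup>i (b3 b4)\<^sup>j b4\<^sup>k b2\<^sup>l\<close> for \<open>i < 5\<close>, \<open>j < 3\<close>, \<open>k < 2\<close>, \<open>l < 4\<close>. The last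
  two factors run through the quaternion group of order 8; the left multiples of it by the
  first two are its 15 left cosets in the binary icosahedral group. The starting vector
  consists of the coordinates of 1.
\<close>

definition icosian_group :: "zt4 list" where
  "icosian_group =
     sweep 5 (\<lambda>v. mul_h4_root2 (mul_h4_root3 (mul_h4_root4 v))) (sweep 3 (\<lambda>v. mul_h4_root3 (mul_h4_root4 v))
       (sweep 2 mul_h4_root4 (sweep 4 mul_h4_root2 [Zt4 0 2 1 3 2 4 2 3])))"

lemma icosian_one: "icosian (Zt4 0 2 1 3 2 4 2 3) = 1"
  by (simp add: icosian_components ztau_def one_cl3_def field_simps tau_simps)

lemma length_icosian_group: "length icosian_group = 120"
  by code_simp

lemma distinct_icosian_group: "distinct icosian_group"
  by code_simp

lemma mul_h4_root_icosian_group: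
  "list_all (\<lambda>v. mul_h4_root2 v \<in> set icosian_group) icosian_group"
  "list_all (\<lambda>v. mul_h4_root3 v \<in> set icosian_group) icosian_group"
  "list_all (\<lambda>v. mul_h4_root4 v \<in> set icosian_group) icosian_group"
  subgoal by code_simp
  subgoal by code_simp
  subgoal by code_simp
  done

lemma one_icosian_group: "Zt4 0 2 1 3 2 4 2 3 \<in> set icosian_group"
  by code_simp

definition binary_icosahedral :: "cl3 set" where "binary_icosahedral = icosian ` set icosian_group"

lemma card_binary_icosahedral: "card binary_icosahedral = 120"
  using length_icosian_group distinct_icosian_group inj_on_subset[OF inj_icosian]
  by (simp add: binary_icosahedral_def card_image distinct_card)

lemma binary_icosahedral_one: "1 \<in> binary_icosahedral"
  using one_icosian_group icosian_one unfolding binary_icosahedral_def by (metis imageI)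

lemma binary_icosahedral_h4_root_mult:
  assumes "g \<in> binary_icosahedral"
  shows "h4_root2 * g \<in> binary_icosahedral"
    "h4_root3 * g \<in> binary_icosahedral" "h4_root4 * g \<in> binary_icosahedral"
  using assms mul_h4_root_icosian_group by (auto simp: binary_icosahedral_def h4_root_mult_icosian list_all_iff)

lemma binary_icosahedral_minus: "g \<in> binary_icosahedral \<Longrightarrow> - g \<in> binary_icosahedral"
proof -
  assume "g \<in> binary_icosahedral"
  then have "h4_root2 * (h4_root2 * g) \<in> binary_icosahedral" by (intro binary_icosahedral_h4_root_mult)
  moreover have "h4_root2 * h4_root2 = - 1"
    by (simp add: h4_root_components one_cl3_def uminus_cl3_def times_cl3_def)
  then have "h4_root2 * (h4_root2 * g) = - g" by (simp flip: mult.assoc)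
  ultimately show ?thesis by simp
qed

lemma binary_icosahedral_even: "g \<in> binary_icosahedral \<Longrightarrow> cl_even g"
proof -
  have "cl_even (icosian v)" for v
    by (cases v) (simp add: icosian_components cl_even_def)
  then show "g \<in> binary_icosahedral \<Longrightarrow> cl_even g" by (auto simp: binary_icosahedral_def)
qed

lemma alpha_eq:
  "alpha1 = - (cl_I * h4_root2)" "alpha2 = - (cl_I * h4_root3)" "alpha3 = - (cl_I * h4_root4)"
  by (simp_all add: h4_root2_def h4_root3_def h4_root4_def cl_I_square)

text \<open>
  Since \<open>alpha1 = - cl_I b2\<close> for the bivector \<open>b2 = h4_root2\<close>, and similarly for the
  other two, left multiplication by a simple root exchanges the two halves of the
  right-hand side. A set that contains 1 and is closed under left multiplication by the
  generators contains the generated group.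
\<close>

lemma pinors_subset: "pinors \<subseteq> binary_icosahedral \<union> (*) cl_I ` binary_icosahedral"
proof -
  let ?S = "binary_icosahedral \<union> (*) cl_I ` binary_icosahedral"
  have step: "a * s \<in> ?S" if "a \<in> {alpha1, alpha2, alpha3}" "s \<in> ?S" for a s
  proof -
    obtain b where a: "a = - (cl_I * b)" and b: "b \<in> {h4_root2, h4_root3, h4_root4}"
      using \<open>a \<in> _\<close> alpha_eq by auto
    have closed: "b * g \<in> binary_icosahedral" if "g \<in> binary_icosahedral" for g
      using that b binary_icosahedral_h4_root_mult by auto
    from \<open>s \<in> ?S\<close> show ?thesis
    proof
      assume "s \<in> binary_icosahedral"
      moreover have "a * s = cl_I * (- (b * s))" by (simp add: a mult.assoc)
      ultimately show ?thesis using closed binary_icosahedral_minus by blast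
    next
      assume "s \<in> (*) cl_I ` binary_icosahedral"
      then obtain g where g: "g \<in> binary_icosahedral" "s = cl_I * g" by blast
      then have "a * s = b * g"
        by (simp add: a mult.assoc cl_I_left_commute[of b] cl_I_square)
      then show ?thesis using g closed by simp
    qed
  qed
  have "\<forall>s\<in>?S. A * s \<in> ?S" if "A \<in> pinors" for A
    using that by (induction rule: pinors_induct) (use step in \<open>simp_all add: mult.assoc\<close>)
  then show ?thesis using binary_icosahedral_one by force
qed

text \<open>
  The central inversion of \<open>H3\<close> is the fifth power of the Coxeter element (the Coxeter
  number is 10). On the level of pinors, \<open>alpha1 alpha2 alpha3 = cl_I b2 b3 b4\<close>, the
  icosian \<open>b2 b3 b4\<close> has order 5, and \<open>cl_I\<^sup>5 = cl_I\<close>.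
\<close>

lemma cl_I_pinors: "cl_I \<in> pinors"
proof -
  let ?c = "alpha1 * alpha2 * alpha3" and ?u = "Zt4 0 2 1 3 2 4 2 3"
  define m where "m = (\<lambda>v. mul_h4_root2 (mul_h4_root3 (mul_h4_root4 v)))"
  have c: "?c * icosian v = cl_I * icosian (m v)" for v
    by (simp add: alpha_eq mult.assoc cl_I_left_commute[of h4_root2] cl_I_left_commute[of h4_root3]
        cl_I_square h4_root_mult_icosian m_def)
  have "m (m (m (m (m ?u)))) = ?u" unfolding m_def by code_simp
  then have "?c * (?c * (?c * (?c * (?c * icosian ?u)))) = cl_I * icosian ?u"
    by (simp only: c cl_I_left_commute[of ?c]) (simp add: cl_I_square)
  then have "?c * (?c * (?c * (?c * (?c * 1)))) = cl_I" by (simp add: icosian_one)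
  then show ?thesis using alpha_pinors pinors_mult pinors_one by metis
qed

lemma h4_root_pinors: "h4_root2 \<in> pinors" "h4_root3 \<in> pinors" "h4_root4 \<in> pinors"
  by (simp_all add: h4_root2_def h4_root3_def h4_root4_def pinors_mult cl_I_pinors alpha_pinors)

text \<open>
  With \<open>cl_I\<close> in the group, the bivectors and hence all listed products are pinors.
  Conversely an even pinor cannot lie in the odd half \<open>cl_I G\<close>.
\<close>

lemma spinors_eq: "spinors = binary_icosahedral"
proof
  show "spinors \<subseteq> binary_icosahedral"
  proof
    fix A assume "A \<in> spinors"
    then have "A \<in> pinors" "cl_even A" by (simp_all add: spinors_def)
    moreover have False if "g \<in> binary_icosahedral" "A = cl_I * g" for g
      using that \<open>cl_even A\<close> binary_icosahedral_even cl_odd_cl_I_mult pinors_versor[OF \<open>A \<in> pinors\<close>]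
        versor_odd_iff by blast
    ultimately show "A \<in> binary_icosahedral" using pinors_subset by blast
  qed
  have "\<forall>v\<in>set icosian_group. icosian v \<in> pinors"
    unfolding icosian_group_def
    by (intro sweep_invariant)
      (simp_all add: icosian_one pinors_one pinors_mult h4_root_pinors
        flip: h4_root_mult_icosian)
  then show "binary_icosahedral \<subseteq> spinors" using binary_icosahedral_even by (auto simp: binary_icosahedral_def spinors_def)
qed

lemma pinors_eq: "pinors = spinors \<union> (\<lambda>R. cl_I * R) ` spinors"
  using pinors_subset cl_I_pinors pinors_mult by (auto simp: spinors_eq[symmetric] spinors_def)

lemma card_pinors: "card pinors = 240"
proof -
  have fin: "finite spinors" by (simp add: spinors_eq binary_icosahedral_def)
  have inj: "inj ((*) cl_I)"
    by (rule injI) (metis cl_I_square(2) neg_equal_iff_equal)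
  have "card ((*) cl_I ` spinors) = 120"
    using inj_on_subset[OF inj] by (simp add: card_image spinors_eq card_binary_icosahedral)
  moreover have "spinors \<inter> (*) cl_I ` spinors = {}"
    using versor_odd_iff pinors_versor cl_odd_cl_I_mult by (auto simp: spinors_def)
  ultimately show ?thesis
    using fin by (simp add: pinors_eq card_Un_disjoint spinors_eq[symmetric] card_binary_icosahedral[folded spinors_eq])
qed

lemma pinors_minus: "A \<in> pinors \<Longrightarrow> - A \<in> pinors"
  using pinors_mult[OF cl_I_pinors pinors_mult[OF cl_I_pinors]] by (simp add: cl_I_square)

lemma pinor_neq_minus: "A \<in> pinors \<Longrightarrow> A \<noteq> - A"
  using versor_nonzero[OF pinors_versor]
  by (auto simp: cl3_eq_iff zero_cl3_def uminus_cl3_def)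

lemma pinor_action_fibre:
  assumes "A \<in> pinors"
  shows "{B \<in> pinors. pinor_action B = pinor_action A} = {A, - A}"
  using assms pinors_minus pinor_action_eq_iff[of A] pinors_versor by auto

lemma card_H3: "card H3 = 120"
proof -
  have fin: "finite pinors" using card_pinors card.infinite by fastforce
  have "card pinors = (\<Sum>f\<in>H3. \<Sum>A | A \<in> pinors \<and> pinor_action A = f. 1)"
    using sum.image_gen[OF fin, of "\<lambda>_. 1 :: nat" pinor_action] by (simp add: pinor_action_image)
  also have "\<dots> = (\<Sum>f\<in>H3. 2)"
  proof (rule sum.cong)
    fix f assume "f \<in> H3"
    then obtain A where "A \<in> pinors" "f = pinor_action A" using pinor_action_image by blast
    then show "(\<Sum>A | A \<in> pinors \<and> pinor_action A = f. 1) = (2::nat)"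
      by (simp add: pinor_action_fibre pinor_neq_minus)
  qed simp
  finally show ?thesis using card_pinors by simp
qed

section \<open>Reflections of \<open>Phi\<close>\<close>

lemma spinors_mult: "g \<in> spinors \<Longrightarrow> h \<in> spinors \<Longrightarrow> g * h \<in> spinors"
  by (simp add: spinors_def pinors_mult parity_mult)

lemma spinors_rev: "g \<in> spinors \<Longrightarrow> cl_rev g \<in> spinors"
  by (simp add: spinors_def pinors_rev cl_rev_parity)

lemma spinors_minus: "g \<in> spinors \<Longrightarrow> - g \<in> spinors"
  by (simp add: spinors_def pinors_minus)

lemma spinors_unit: "g \<in> spinors \<Longrightarrow> g * cl_rev g = 1" "g \<in> spinors \<Longrightarrow> cl_rev g * g = 1"
  using pinors_versor by (auto simp: spinors_def versor_def)

text \<open>Because \<open>cl_I\<^sup>2 = -1\<close> and \<open>-1\<close> is a spinor, \<open>Phi = G \<union> tau G\<close> for the spinor group \<open>G\<close>.\<close>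

lemma Phi_iff: "x \<in> Phi \<longleftrightarrow> (\<exists>s\<in>{1, tau}. \<exists>g\<in>spinors. x = s *\<^sub>R g)"
proof -
  have "{tau *\<^sub>R (cl_I * Q) | Q. Q \<in> (\<lambda>R. cl_I * R) ` spinors}
      = (\<lambda>Q. tau *\<^sub>R (cl_I * Q)) ` (\<lambda>R. cl_I * R) ` spinors" by blast
  also have "\<dots> = (\<lambda>g. tau *\<^sub>R (- g)) ` spinors"
    by (simp only: image_image cl_I_square)
  also have "\<dots> = (\<lambda>g. tau *\<^sub>R g) ` spinors"
    using spinors_minus by (force simp: image_iff)
  finally show ?thesis by (auto simp: Phi_def)
qed

lemma Phi_scale: "s \<in> {1, tau} \<Longrightarrow> g \<in> spinors \<Longrightarrow> s *\<^sub>R g \<in> Phi"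
  by (auto simp: Phi_iff)

lemma Phi_minus: "x \<in> Phi \<Longrightarrow> - x \<in> Phi"
  unfolding Phi_iff by (metis scaleR_minus_right spinors_minus)

lemma Phi_mult_spinor: "x \<in> Phi \<Longrightarrow> h \<in> spinors \<Longrightarrow> x * h \<in> Phi"
  unfolding Phi_iff by (metis mult_scaleR_left spinors_mult)

text \<open>
  The conjugacy classes of the binary icosahedral group: the real part is \<open>cos \<theta>\<close> with \<open>\<theta>\<close> a
  multiple of \<open>\<pi>/5\<close>, \<open>\<pi>/3\<close> or \<open>\<pi>/2\<close>. The pairs are the possible \<open>h4_root1\<close>-coefficients
  \<open>p + tau q\<close>; the real part is \<open>(tau - 1)/2\<close> times that coefficient.
\<close>

lemma spinor_real_part:
  assumes "g \<in> spinors"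
  obtains u where "u \<in> {0, 1, 2, tau, tau - 1}" "2 * c0 g = u \<or> 2 * c0 g = - u"
proof -
  have "list_all (\<lambda>Zt4 p q _ _ _ _ _ _ \<Rightarrow>
      (p, q) \<in> set [(0, 0), (0, 1), (0, -1), (0, 2), (0, -2), (1, 1), (-1, -1), (1, 0), (-1, 0)])
    icosian_group" by code_simp
  then have real_parts: "\<forall>v\<in>set icosian_group. case v of Zt4 p q _ _ _ _ _ _ \<Rightarrow>
      (p, q) \<in> {(0, 0), (0, 1), (0, -1), (0, 2), (0, -2), (1, 1), (-1, -1), (1, 0), (-1, 0)}"
    by (simp only: list_all_iff list.set)
  obtain v where v: "v \<in> set icosian_group" "g = icosian v"
    using assms by (auto simp: spinors_eq binary_icosahedral_def)
  obtain p q p2 q2 p3 q3 p4 q4 where v': "v = Zt4 p q p2 q2 p3 q3 p4 q4" by (cases v)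
  have "(p, q) \<in> {(0, 0), (0, 1), (0, -1), (0, 2), (0, -2), (1, 1), (-1, -1), (1, 0), (-1, 0)}"
    using bspec[OF real_parts v(1)] by (simp only: v' zt4.case)
  moreover have "2 * c0 g = ztau p q * (tau - 1)" by (simp add: v v' icosian_components)
  ultimately have "\<exists>u\<in>{0, 1, 2, tau, tau - 1}. 2 * c0 g = u \<or> 2 * c0 g = - u"
    by (auto simp: ztau_def algebra_simps tau_simps)
  then show thesis using that by blast
qed

text \<open>
  The characteristic equation of a unit quaternion of trace \<open>u\<close>. It makes small
  combinations of \<open>1\<close> and \<open>k\<close> multiples of powers of \<open>k\<close>.
\<close>

lemma spinor_quadratic:
  assumes "k \<in> spinors" "2 * c0 k = u"
  shows "cl_rev k = u *\<^sub>R 1 - k" "k * k = u *\<^sub>R k - 1" "k * k * k = (u * u - 1) *\<^sub>R k - u *\<^sub>R 1"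
proof -
  show rev: "cl_rev k = u *\<^sub>R 1 - k"
    using assms by (simp add: spinors_def cl_even_def cl_rev_def cl3_defs cl3_eq_iff)
  show sq: "k * k = u *\<^sub>R k - 1"
    using spinors_unit(1)[OF assms(1)] by (simp add: rev right_diff_distrib algebra_simps)
  show "k * k * k = (u * u - 1) *\<^sub>R k - u *\<^sub>R 1"
    by (simp add: sq left_diff_distrib algebra_simps)
qed

text \<open>
  The reflection of \<open>s k\<close> in the root \<open>t 1\<close>, for \<open>s, t \<in> {1, tau}\<close>. Twice the inner
  product of the two is \<open>s t\<close> times the trace \<open>2 c0 k\<close>; its rational part is the integer \<open>n\<close>,
  so the reflection of \<open>s k\<close> is \<open>s k - n t\<close>.
\<close>

definition root_step :: "real \<Rightarrow> real \<Rightarrow> cl3 \<Rightarrow> bool" where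
  "root_step s t k \<longleftrightarrow>
     (\<exists>n m :: int. s * t * (2 * c0 k) = of_int n + tau * of_int m \<and>
        s *\<^sub>R k - (of_int n * t) *\<^sub>R 1 \<in> Phi)"

lemma root_stepI:
  assumes "s * t * (2 * c0 k) = of_int n + tau * of_int m"
    and "x \<in> Phi" "s *\<^sub>R k - (of_int n * t) *\<^sub>R 1 = x"
  shows "root_step s t k"
  using assms unfolding root_step_def by blast

text \<open>
  The reflected vector is a power of \<open>k\<close> up to sign and a factor \<open>tau\<close>. For the trace \<open>tau\<close>,
  say, \<open>k\<close> is a rotation by \<open>\<pi>/5\<close> in the plane of \<open>1\<close> and \<open>k\<close>, and \<open>tau (k - 1)\<close> is a unit vector
  at angle \<open>3\<pi>/5\<close>, that is, \<open>k\<^sup>3\<close>. In each of the instances below, \<open>x\<close> is the reflected vector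
  and \<open>n + tau m\<close> is twice the inner product.
\<close>

lemma root_step_nonneg:
  assumes k: "k \<in> spinors" and u: "2 * c0 k = u" "u \<in> {0, 1, 2, tau, tau - 1}"
    and st: "s \<in> {1, tau}" "t \<in> {1, tau}"
  shows "root_step s t k"
proof -
  define r k2 k3 where "r = cl_rev k" and "k2 = k * k" and "k3 = k * k * k"
  note quad = spinor_quadratic[OF k u(1), folded r_def k2_def k3_def]
  have "k \<in> spinors" "r \<in> spinors" "k2 \<in> spinors" "k3 \<in> spinors"
    using k by (simp_all add: r_def k2_def k3_def spinors_mult spinors_rev)
  then have "x \<in> Phi" "tau *\<^sub>R x \<in> Phi" "- x \<in> Phi" "- (tau *\<^sub>R x) \<in> Phi" if "x \<in> {k, r, k2, k3}" for x
    using that Phi_scale[of 1] Phi_scale[of tau] Phi_minus by auto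
  note in_Phi = this[of k, simplified] this[of r, simplified] this[of k2, simplified] this[of k3, simplified]
  have c0: "c0 k = u / 2" using u(1) by simp
  note red = cl3_eq_iff cl3_defs algebra_simps tau_simps
  from u(2) consider "u = 0" | "u = 1" | "u = 2" | "u = tau" | "u = tau - 1" by blast
  then show ?thesis
  proof cases
    case 1
    note case_u = 1 and pow = 1 quad
    have "root_step 1 1 k"
      by (rule root_stepI[where x = k and n = 0 and m = 0],
        simp add: c0 case_u tau_simps field_simps, rule in_Phi, simp add: pow red)
    moreover have "root_step 1 tau k"
      by (rule root_stepI[where x = k and n = 0 and m = 0],
        simp add: c0 case_u tau_simps field_simps, rule in_Phi, simp add: pow red)
    moreover have "root_step tau 1 k"
      by (rule root_stepI[where x = "tau *\<^sub>R k" and n = 0 and m = 0],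
        simp add: c0 case_u tau_simps field_simps, rule in_Phi, simp add: pow red)
    moreover have "root_step tau tau k"
      by (rule root_stepI[where x = "tau *\<^sub>R k" and n = 0 and m = 0],
        simp add: c0 case_u tau_simps field_simps, rule in_Phi, simp add: pow red)
    ultimately show ?thesis using st by blast
  next
    case 2
    note case_u = 2 and pow = 2 quad
    have "root_step 1 1 k"
      by (rule root_stepI[where x = k2 and n = 1 and m = 0],
        simp add: c0 case_u tau_simps field_simps, rule in_Phi, simp add: pow red)
    moreover have "root_step 1 tau k"
      by (rule root_stepI[where x = k and n = 0 and m = 1],
        simp add: c0 case_u tau_simps field_simps, rule in_Phi, simp add: pow red)
    moreover have "root_step tau 1 k"
      by (rule root_stepI[where x = "tau *\<^sub>R k" and n = 0 and m = 1],
        simp add: c0 case_u tau_simps field_simps, rule in_Phi, simp add: pow red)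
    moreover have "root_step tau tau k"
      by (rule root_stepI[where x = "tau *\<^sub>R k2" and n = 1 and m = 1],
        simp add: c0 case_u tau_simps field_simps, rule in_Phi, simp add: pow red)
    ultimately show ?thesis using st by blast
  next
    case 3
    have "c0 k * c0 k + c23 k * c23 k + c31 k * c31 k + c12 k * c12 k = 1" "cl_even k"
      using spinors_unit(1)[OF k] k
      by (simp_all add: spinors_def cl_even_def cl_rev_def cl3_defs)
    then have "c0 k = 1" "c23 k * c23 k + c31 k * c31 k + c12 k * c12 k = 0" "cl_even k"
      using 3 u by simp_all
    then have "k = 1"
      by (simp add: cl_even_def cl3_eq_iff one_cl3_def add_nonneg_eq_0_iff)
    note case_u = 3 and pow = this
    have "root_step 1 1 k"
      by (rule root_stepI[where x = "- k" and n = 2 and m = 0],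
        simp add: c0 case_u tau_simps field_simps, rule in_Phi, simp add: pow red)
    moreover have "root_step 1 tau k"
      by (rule root_stepI[where x = k and n = 0 and m = 2],
        simp add: c0 case_u tau_simps field_simps, rule in_Phi, simp add: pow red)
    moreover have "root_step tau 1 k"
      by (rule root_stepI[where x = "tau *\<^sub>R k" and n = 0 and m = 2],
        simp add: c0 case_u tau_simps field_simps, rule in_Phi, simp add: pow red)
    moreover have "root_step tau tau k"
      by (rule root_stepI[where x = "- (tau *\<^sub>R k)" and n = 2 and m = 2],
        simp add: c0 case_u tau_simps field_simps, rule in_Phi, simp add: pow red)
    ultimately show ?thesis using st by blast
  next
    case 4
    note case_u = 4 and pow = 4 quad
    have "root_step 1 1 k"
      by (rule root_stepI[where x = k and n = 0 and m = 1],
        simp add: c0 case_u tau_simps field_simps, rule in_Phi, simp add: pow red)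
    moreover have "root_step 1 tau k"
      by (rule root_stepI[where x = "- r" and n = 1 and m = 1],
        simp add: c0 case_u tau_simps field_simps, rule in_Phi, simp add: pow red)
    moreover have "root_step tau 1 k"
      by (rule root_stepI[where x = k2 and n = 1 and m = 1],
        simp add: c0 case_u tau_simps field_simps, rule in_Phi, simp add: pow red)
    moreover have "root_step tau tau k"
      by (rule root_stepI[where x = k3 and n = 1 and m = 2],
        simp add: c0 case_u tau_simps field_simps, rule in_Phi, simp add: pow red)
    ultimately show ?thesis using st by blast
  next
    case 5
    note case_u = 5 and pow = 5 quad
    have "root_step 1 1 k"
      by (rule root_stepI[where x = "- (tau *\<^sub>R k3)" and n = "-1" and m = 1],
        simp add: c0 case_u tau_simps field_simps, rule in_Phi, simp add: pow red)
    moreover have "root_step 1 tau k"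
      by (rule root_stepI[where x = "tau *\<^sub>R k2" and n = 1 and m = 0],
        simp add: c0 case_u tau_simps field_simps, rule in_Phi, simp add: pow red)
    moreover have "root_step tau 1 k"
      by (rule root_stepI[where x = "- (tau *\<^sub>R r)" and n = 1 and m = 0],
        simp add: c0 case_u tau_simps field_simps, rule in_Phi, simp add: pow red)
    moreover have "root_step tau tau k"
      by (rule root_stepI[where x = "tau *\<^sub>R k" and n = 0 and m = 1],
        simp add: c0 case_u tau_simps field_simps, rule in_Phi, simp add: pow red)
    ultimately show ?thesis using st by blast
  qed
qed

lemma root_step_spinor:
  assumes k: "k \<in> spinors" and st: "s \<in> {1, tau}" "t \<in> {1, tau}"
  shows "root_step s t k"
proof -
  obtain u where u: "u \<in> {0, 1, 2, tau, tau - 1}" "2 * c0 k = u \<or> 2 * c0 k = - u"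
    using spinor_real_part[OF k] .
  show ?thesis
  proof (cases "2 * c0 k = u")
    case True
    then show ?thesis using root_step_nonneg k u(1) st by blast
  next
    case False
    then have "2 * c0 (- k) = u" using u(2) by (simp add: uminus_cl3_def)
    then have "root_step s t (- k)" using root_step_nonneg[OF spinors_minus[OF k]] u(1) st by blast
    then obtain n m :: int where n: "s * t * (2 * c0 (- k)) = of_int n + tau * of_int m"
      "s *\<^sub>R (- k) - (of_int n * t) *\<^sub>R 1 \<in> Phi" by (auto simp: root_step_def)
    have "s * t * (2 * c0 k) = of_int (- n) + tau * of_int (- m)"
      using n(1) by (simp add: uminus_cl3_def)
    moreover have "s *\<^sub>R k - (of_int (- n) * t) *\<^sub>R 1 \<in> Phi"
      using Phi_minus[OF n(2)] by (simp add: add.commute)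
    ultimately show ?thesis unfolding root_step_def by blast
  qed
qed

lemma cl_inner_scaleR: "cl_inner (s *\<^sub>R x) (t *\<^sub>R y) = s * t * c0 (x * cl_rev y)"
  by (simp add: cl_inner_def cl_rev_def cl3_defs algebra_simps)

text \<open>
  Right multiplication by a spinor \<open>h\<close> preserves \<open>Phi\<close> and the inner product, so the root
  \<open>y = t h\<close> can be moved to \<open>t\<close>. This transports the computation for the roots 1 and \<open>tau\<close> to
  every root, and yields integrality of the Cartan numbers together with closure under
  reflections.
\<close>

lemma Phi_step:
  assumes "x \<in> Phi" "y \<in> Phi"
  obtains n :: int where "reduced_inner x y = of_int n / 2" "x - of_int n *\<^sub>R y \<in> Phi"
proof -
  obtain s g t h where x: "s \<in> {1, tau}" "g \<in> spinors" "x = s *\<^sub>R g"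
    and y: "t \<in> {1, tau}" "h \<in> spinors" "y = t *\<^sub>R h"
    using assms unfolding Phi_iff by blast
  define k where "k = g * cl_rev h"
  have k: "k \<in> spinors" using x y by (simp add: k_def spinors_mult spinors_rev)
  then obtain n m :: int where n: "s * t * (2 * c0 k) = of_int n + tau * of_int m"
    "s *\<^sub>R k - (of_int n * t) *\<^sub>R 1 \<in> Phi"
    using root_step_spinor x y unfolding root_step_def by blast
  have "s * t * c0 k = of_int n / 2 + tau * (of_int m / 2)" using n(1) by simp
  then have "rat_part (s * t * c0 k) = of_int n / 2"
    by (metis rat_part_eq Rats_divide Rats_of_int Rats_number_of)
  have "g = k * h" using spinors_unit(2)[OF y(2)] by (simp add: k_def mult.assoc)
  then have "x - of_int n *\<^sub>R y = (s *\<^sub>R k - (of_int n * t) *\<^sub>R 1) * h"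
    by (simp add: x y left_diff_distrib)
  then have "x - of_int n *\<^sub>R y \<in> Phi" using Phi_mult_spinor n(2) y(2) by simp
  moreover have "reduced_inner x y = of_int n / 2"
    using \<open>rat_part _ = _\<close> by (simp add: reduced_inner_def x y cl_inner_scaleR flip: k_def)
  ultimately show thesis using that by blast
qed

lemma Phi_norm:
  assumes "x \<in> Phi" shows "reduced_inner x x = 1"
proof -
  obtain s g where x: "s \<in> {1, tau}" "g \<in> spinors" "x = s *\<^sub>R g"
    using assms unfolding Phi_iff by blast
  have "cl_inner x x = s * s" by (simp add: x cl_inner_scaleR spinors_unit one_cl3_def)
  moreover have "rat_part 1 = 1" "rat_part (tau * tau) = 1"
    using Q_tau_rat(2)[of 1] Q_tau_mult(2)[OF Q_tau_tau(1) Q_tau_tau(1)] Q_tau_tau by simp_all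
  ultimately show ?thesis using x(1) by (auto simp: reduced_inner_def)
qed

text \<open>The two halves of \<open>Phi\<close> are disjoint since they have full norms \<open>1\<close> and \<open>tau\<^sup>2\<close>.\<close>

lemma card_Phi: "card Phi = 240"
proof -
  have fin: "finite spinors" and card: "card spinors = 120"
    by (simp_all add: spinors_eq card_binary_icosahedral) (simp add: binary_icosahedral_def)
  have tau: "tau > 1" by (simp add: tau_def)
  have Phi: "Phi = spinors \<union> (\<lambda>g. tau *\<^sub>R g) ` spinors" by (auto simp: Phi_iff)
  have "inj ((*\<^sub>R) tau :: cl3 \<Rightarrow> cl3)" using tau by (intro injI) simp
  then have "card ((\<lambda>g. tau *\<^sub>R g) ` spinors) = 120"
    using card inj_on_subset by (subst card_image) auto
  moreover have "spinors \<inter> (\<lambda>g. tau *\<^sub>R g) ` spinors = {}"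
  proof -
    have False if "g \<in> spinors" "h \<in> spinors" "g = tau *\<^sub>R h" for g h
    proof -
      have "1 = cl_inner g g" using that(1) cl_inner_scaleR[of 1 g 1 g]
        by (simp add: spinors_unit one_cl3_def)
      also have "\<dots> = tau * tau" using that(2) unfolding that(3) cl_inner_scaleR
        by (simp add: spinors_unit one_cl3_def)
      finally show False using tau by (simp add: tau_squared)
    qed
    then show ?thesis by blast
  qed
  ultimately show ?thesis using fin card by (simp add: Phi card_Un_disjoint)
qed

section \<open>The real form\<close>

lemma even_Q_tau_add: "x \<in> even_Q_tau \<Longrightarrow> y \<in> even_Q_tau \<Longrightarrow> x + y \<in> even_Q_tau"
  by (simp add: even_Q_tau_def cl_even_def plus_cl3_def Q_tau_add)

lemma even_Q_tau_scale: "z \<in> Q_tau \<Longrightarrow> x \<in> even_Q_tau \<Longrightarrow> z *\<^sub>R x \<in> even_Q_tau"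
  by (simp add: even_Q_tau_def cl_even_def scaleR_cl3_def Q_tau_mult)

lemma ztau_Q_tau: "ztau p q \<in> Q_tau"
  by (simp add: ztau_def Q_tauI)

lemma Q_tau_of_int: "of_int n \<in> Q_tau"
  by (simp add: Q_tau_rat)

lemma h4_root_even_Q_tau:
  "h4_root1 \<in> even_Q_tau" "h4_root2 \<in> even_Q_tau" "h4_root3 \<in> even_Q_tau" "h4_root4 \<in> even_Q_tau"
proof -
  have *: "(of_int a + tau * of_int b) / 2 \<in> Q_tau" for a b
    using Q_tauI[of "of_int a / 2" "of_int b / 2"] by (simp add: add_divide_distrib)
  show "h4_root1 \<in> even_Q_tau" "h4_root2 \<in> even_Q_tau" "h4_root3 \<in> even_Q_tau" "h4_root4 \<in> even_Q_tau"
    using *[of 0 0] *[of "- 1" 1] *[of 1 "- 1"] *[of "- 1" 0] *[of 2 0] *[of 0 1] *[of 0 "- 1"]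
    by (simp_all add: even_Q_tau_def cl_even_def h4_root1_def h4_root_components)
qed

lemma icosian_even_Q_tau: "icosian v \<in> even_Q_tau"
  by (cases v) (simp add: icosian.simps even_Q_tau_add even_Q_tau_scale ztau_Q_tau h4_root_even_Q_tau)

lemma Phi_even_Q_tau: "Phi \<subseteq> even_Q_tau"
  using Q_tau_rat(1)[of 1] Q_tau_tau(1)
  by (auto simp: Phi_iff spinors_eq binary_icosahedral_def icosian_even_Q_tau even_Q_tau_scale)

text \<open>
  The rational parts of 1, \<open>tau\<close> and \<open>tau\<^sup>2\<close> are 1, 0 and 1, so the \<open>\<rat>\<close>-basis of the \<open>u\<^sub>i\<close> and
  \<open>tau u\<^sub>i\<close>, \<open>u\<^sub>i = even_unit i\<close>, is orthonormal and the form is the Euclidean inner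
  product.
\<close>

lemma reduced_form_inner: "reduced_form v w = v \<bullet> w"
proof -
  have rat: "rat_part 0 = 0" "rat_part 1 = 1" "rat_part tau = 0" "rat_part (tau * tau) = 1"
    by (simp_all add: Q_tau_rat Q_tau_tau Q_tau_mult)
  have "c0 (even_unit i * cl_rev (even_unit j)) = (if i = j then 1 else 0)" for i j
    using exhaust_4[of i] exhaust_4[of j]
    by (auto simp: even_unit_simps times_cl3_def cl_rev_def)
  then have "cl_inner (r *\<^sub>R even_unit i) (s *\<^sub>R even_unit j) = (if i = j then r * s else 0)"
    for r s i j by (simp add: cl_inner_scaleR)
  note * = this this[of 1 _ 1, simplified] this[of 1 _ tau, simplified] this[of tau _ 1, simplified]
  show ?thesis
    by (simp add: reduced_form_def reduced_inner_def * rat sum.distrib inner_prod_def inner_vec_def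
        if_distrib cong: if_cong)
qed

lemma reflect_scalar_ext:
  assumes "x \<in> Phi" "y \<in> Phi"
  shows "reflect reduced_form (scalar_ext y) (scalar_ext x) \<in> scalar_ext ` Phi"
proof -
  obtain n :: int where n: "reduced_inner x y = of_int n / 2" "x - of_int n *\<^sub>R y \<in> Phi"
    using Phi_step[OF assms] .
  have xy: "x \<in> even_Q_tau" "y \<in> even_Q_tau" using assms Phi_even_Q_tau by auto
  have "x - of_int n *\<^sub>R y = x + of_int (- n) *\<^sub>R y" by simp
  then have "scalar_ext (x - of_int n *\<^sub>R y) = scalar_ext x + of_int (- n) *\<^sub>R scalar_ext y"
    using xy by (simp only: scalar_ext_add scalar_ext_scale even_Q_tau_scale Q_tau_of_int Rats_of_int)
  also have "\<dots> = reflect reduced_form (scalar_ext y) (scalar_ext x)"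
    by (simp add: reflect_def reduced_form_scalar_ext xy n(1) Phi_norm assms)
  finally show ?thesis using n(2) by (metis imageI)
qed

section \<open>Simple roots of type \<open>E8\<close>\<close>

\<comment> \<open>keeps the index 1 a numeral, like the indices 2 to 8\<close>
declare One_nat_def [simp del]

text \<open>
  The simple roots of \<open>E8\<close> are the simple roots of \<open>H4\<close> and their multiples by \<open>tau\<close>. An edge
  of order 3, with inner product \<open>-1/2\<close>, gives one edge in each of the two copies. The edge
  of order 5, with inner product \<open>-tau/2\<close>, has reduced inner product 0 in the first copy and
  \<open>-1/2\<close> in the other three pairings; these join the copies to the \<open>E8\<close> diagram. The order
  follows the Bourbaki numbering, with branch node \<open>tau h4_root3\<close>.
\<close>

definition e8_simple :: "nat \<Rightarrow> cl3" where
  "e8_simple i = [tau *\<^sub>R h4_root1, h4_root4, tau *\<^sub>R h4_root2, tau *\<^sub>R h4_root3, tau *\<^sub>R h4_root4,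
     h4_root3, h4_root2, h4_root1] ! (i - 1)"

definition e8_root :: "nat \<Rightarrow> (real^4) \<times> (real^4)" where
  "e8_root i = scalar_ext (e8_simple i)"

lemma atLeastAtMost_1_8: "{1..8::nat} = {1, 2, 3, 4, 5, 6, 7, 8}"
  by auto

lemma e8_simple_simps:
  "e8_simple 1 = tau *\<^sub>R h4_root1" "e8_simple 2 = h4_root4" "e8_simple 3 = tau *\<^sub>R h4_root2"
  "e8_simple 4 = tau *\<^sub>R h4_root3" "e8_simple 5 = tau *\<^sub>R h4_root4" "e8_simple 6 = h4_root3"
  "e8_simple 7 = h4_root2" "e8_simple 8 = h4_root1"
  by (simp_all add: e8_simple_def)

lemma h4_root_spinors: "h4_root1 \<in> spinors" "h4_root2 \<in> spinors" "h4_root3 \<in> spinors" "h4_root4 \<in> spinors"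
proof -
  have "h4_root2 * 1 \<in> spinors" "h4_root3 * 1 \<in> spinors" "h4_root4 * 1 \<in> spinors"
    unfolding spinors_eq by (intro binary_icosahedral_h4_root_mult binary_icosahedral_one)+
  then show "h4_root2 \<in> spinors" "h4_root3 \<in> spinors" "h4_root4 \<in> spinors" by simp_all
  have "Zt4 1 0 0 0 0 0 0 0 \<in> set icosian_group" by code_simp
  moreover have "icosian (Zt4 1 0 0 0 0 0 0 0) = h4_root1" by (simp add: icosian.simps ztau_def)
  ultimately show "h4_root1 \<in> spinors" unfolding spinors_eq binary_icosahedral_def by (metis imageI)
qed

lemma e8_simple_Phi: "i \<in> {1..8} \<Longrightarrow> e8_simple i \<in> Phi"
  unfolding atLeastAtMost_1_8
  using Phi_scale[of 1] Phi_scale[of tau] h4_root_spinors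
  by (auto simp: e8_simple_simps)

lemma scalar_ext_eqI:
  assumes "\<forall>i. v $ i \<in> \<rat> \<and> w $ i \<in> \<rat> \<and> even_coeffs x $ i = v $ i + tau * w $ i"
  shows "scalar_ext x = (v, w)"
  using assms by (simp add: scalar_ext_def vec_eq_iff rat_part_eq tau_part_eq)

lemma e8_root_components:
  "e8_root 1 = (vector [1/2, 1/2, 0, 0], vector [0, 1/2, -1/2, 0])"
  "e8_root 2 = (vector [0, 0, 0, 1], vector [0, 0, 0, 0])"
  "e8_root 3 = (vector [0, 0, 0, 0], vector [0, 0, 1, 0])"
  "e8_root 4 = (vector [0, -1/2, 0, -1/2], vector [0, 0, -1/2, -1/2])"
  "e8_root 5 = (vector [0, 0, 0, 0], vector [0, 0, 0, 1])"
  "e8_root 6 = (vector [0, 1/2, -1/2, 0], vector [0, -1/2, 0, -1/2])"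
  "e8_root 7 = (vector [0, 0, 1, 0], vector [0, 0, 0, 0])"
  "e8_root 8 = (vector [-1/2, 0, -1/2, 0], vector [1/2, 1/2, 0, 0])"
  unfolding e8_root_def e8_simple_simps
  by (rule scalar_ext_eqI, simp add: forall_4 even_coeffs_def h4_root1_def h4_root_components
      scaleR_cl3_def field_simps tau_simps)+

lemma e8_gram:
  assumes "i \<in> {1..8}" "j \<in> {1..8}"
  shows "reduced_form (e8_root i) (e8_root j) = of_int (cartan_E8 i j) / 2"
  using assms unfolding atLeastAtMost_1_8
  by (elim insertE emptyE; simp only: e8_root_components reduced_form_inner)
    (simp_all add: inner_prod_def inner_vec_def sum_4 cartan_E8_def doubleton_eq_iff)

lemma e8_norm: "i \<in> {1..8} \<Longrightarrow> reduced_form (e8_root i) (e8_root i) = 1"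
  by (simp add: e8_gram cartan_E8_def)

lemma inj_on_e8_root: "inj_on e8_root {1..8}"
proof (rule inj_onI, rule ccontr)
  fix i j assume ij: "i \<in> {1..8}" "j \<in> {1..8}" "e8_root i = e8_root j" "i \<noteq> j"
  then have "of_int (cartan_E8 i j) / 2 = (1::real)" using e8_gram[of i j] e8_norm[of j] by simp
  then show False using ij(4) by (simp add: cartan_E8_def split: if_splits)
qed

text \<open>A linear relation, paired with each root, lies in the kernel of the Cartan matrix, which is trivial.\<close>

lemma independent_e8: "independent (e8_root ` {1..8})"
proof -
  have zero: "c i = 0" if sum: "(\<Sum>i\<in>{1..8}. c i *\<^sub>R e8_root i) = 0" and i: "i \<in> {1..8}"
    for c :: "nat \<Rightarrow> real" and i
  proof -
    have *: "(\<Sum>i\<in>{1..8}. c i * of_int (cartan_E8 i j)) = 0" if "j \<in> {1..8}" for j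
    proof -
      have "0 = 2 * ((\<Sum>i\<in>{1..8}. c i *\<^sub>R e8_root i) \<bullet> e8_root j)" using sum by simp
      also have "\<dots> = (\<Sum>i\<in>{1..8}. c i * of_int (cartan_E8 i j))"
        using that by (simp add: inner_sum_left sum_distrib_left e8_gram[unfolded reduced_form_inner])
      finally show ?thesis by simp
    qed
    have "c 1 = 0 \<and> c 2 = 0 \<and> c 3 = 0 \<and> c 4 = 0 \<and> c 5 = 0 \<and> c 6 = 0 \<and> c 7 = 0 \<and> c 8 = 0"
      using *[of 1] *[of 2] *[of 3] *[of 4] *[of 5] *[of 6] *[of 7] *[of 8]
      by (simp add: atLeastAtMost_1_8 cartan_E8_def doubleton_eq_iff)
    then show ?thesis using i unfolding atLeastAtMost_1_8 by auto
  qed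
  show ?thesis
  proof (rule independent_if_scalars_zero)
    fix f x assume f: "(\<Sum>x\<in>e8_root ` {1..8}. f x *\<^sub>R x) = 0" and "x \<in> e8_root ` {1..8}"
    then obtain i where i: "i \<in> {1..8}" "x = e8_root i" by blast
    have "(\<Sum>i\<in>{1..8}. f (e8_root i) *\<^sub>R e8_root i) = 0"
      using f by (simp add: sum.reindex[OF inj_on_e8_root])
    then show "f x = 0" using zero[of "\<lambda>i. f (e8_root i)"] i by simp
  qed simp
qed

lemma span_e8: "span (e8_root ` {1..8}) = UNIV"
proof -
  have "dim (e8_root ` {1..8}) = 8"
    using independent_e8 by (simp add: dim_eq_card_independent card_image inj_on_e8_root)
  then show ?thesis by (subst dim_eq_full[symmetric]) simp
qed

fun mul_tau :: "zt4 \<Rightarrow> zt4" where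
  "mul_tau (Zt4 p1 q1 p2 q2 p3 q3 p4 q4) = Zt4 q1 (p1 + q1) q2 (p2 + q2) q3 (p3 + q3) q4 (p4 + q4)"

lemma tau_icosian: "tau *\<^sub>R icosian v = icosian (mul_tau v)"
proof -
  have "tau * ztau p q = ztau q (p + q)" for p q by (simp add: ztau_def algebra_simps tau_simps)
  then show ?thesis by (cases v) (simp add: icosian.simps scaleR_add_right)
qed

fun e8_coords :: "zt4 \<Rightarrow> int list" where
  "e8_coords (Zt4 p1 q1 p2 q2 p3 q3 p4 q4) = [q1, p4, q2, q3, q4, p3, p2, p1]"

lemma scalar_ext_icosian:
  "scalar_ext (icosian v) = (\<Sum>i\<in>{1..8}. of_int (e8_coords v ! (i - 1)) *\<^sub>R e8_root i)"
proof (cases v)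
  case (Zt4 p1 q1 p2 q2 p3 q3 p4 q4)
  have tau: "tau *\<^sub>R h4_root1 \<in> even_Q_tau" "tau *\<^sub>R h4_root2 \<in> even_Q_tau" "tau *\<^sub>R h4_root3 \<in> even_Q_tau"
    "tau *\<^sub>R h4_root4 \<in> even_Q_tau"
    by (simp_all add: even_Q_tau_scale Q_tau_tau h4_root_even_Q_tau)
  have "icosian v = of_int p1 *\<^sub>R h4_root1 + of_int q1 *\<^sub>R tau *\<^sub>R h4_root1
      + (of_int p2 *\<^sub>R h4_root2 + of_int q2 *\<^sub>R tau *\<^sub>R h4_root2)
      + (of_int p3 *\<^sub>R h4_root3 + of_int q3 *\<^sub>R tau *\<^sub>R h4_root3)
      + (of_int p4 *\<^sub>R h4_root4 + of_int q4 *\<^sub>R tau *\<^sub>R h4_root4)"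
    by (simp add: Zt4 icosian.simps ztau_def scaleR_add_left mult.commute[of tau])
  then show ?thesis
    by (simp del: scaleR_scaleR add: Zt4 scalar_ext_add scalar_ext_scale even_Q_tau_add even_Q_tau_scale Q_tau_of_int
        tau h4_root_even_Q_tau atLeastAtMost_1_8 e8_root_def e8_simple_simps)
qed

definition same_sign :: "int list \<Rightarrow> bool" where
  "same_sign xs \<longleftrightarrow> list_all (\<lambda>x. 0 \<le> x) xs \<or> list_all (\<lambda>x. x \<le> 0) xs"

text \<open>
  The 120 spinors are the roots of \<open>H4\<close>, so their coefficients over the simple roots have
  one sign. For coefficients \<open>p + tau q\<close> with \<open>p, q \<ge> 0\<close> the product with \<open>tau\<close> is
  \<open>q + tau (p + q)\<close>, which is again of this form. So the enumeration of the spinors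
  suffices for all of \<open>Phi\<close>.
\<close>

lemma Phi_same_sign:
  assumes "x \<in> Phi"
  obtains v where "x = icosian v" "same_sign (e8_coords v)"
proof -
  obtain s g where x: "s \<in> {1, tau}" "g \<in> spinors" "x = s *\<^sub>R g" using assms Phi_iff by blast
  then obtain v where v: "v \<in> set icosian_group" "g = icosian v" by (auto simp: spinors_eq binary_icosahedral_def)
  have "list_all (\<lambda>v. same_sign (e8_coords v)) icosian_group" by code_simp
  then have sign: "same_sign (e8_coords v)" using v by (simp add: list_all_iff)
  show thesis
  proof (cases "s = 1")
    case True
    then show thesis using that v sign x by simp
  next
    case False
    have "same_sign (e8_coords (mul_tau v))" using sign by (cases v) (auto simp: same_sign_def)
    then show thesis using that False x v by (auto simp: tau_icosian)
  qed
qed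

lemma base_of_e8: "base_of (e8_root ` {1..8}) (scalar_ext ` Phi)"
proof -
  have "\<exists>c. \<alpha> = (\<Sum>\<delta>\<in>e8_root ` {1..8}. real (c \<delta>) *\<^sub>R \<delta>) \<or>
            \<alpha> = - (\<Sum>\<delta>\<in>e8_root ` {1..8}. real (c \<delta>) *\<^sub>R \<delta>)" if "\<alpha> \<in> scalar_ext ` Phi" for \<alpha>
  proof -
    obtain x where "x \<in> Phi" "\<alpha> = scalar_ext x" using \<open>\<alpha> \<in> _\<close> by blast
    then obtain v where v: "\<alpha> = scalar_ext (icosian v)" "same_sign (e8_coords v)"
      by (metis Phi_same_sign)
    define n where "n i = e8_coords v ! (i - 1)" for i
    define c where "c \<delta> = nat \<bar>n (inv_into {1..8} e8_root \<delta>)\<bar>" for \<delta>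
    have c: "(\<Sum>\<delta>\<in>e8_root ` {1..8}. real (c \<delta>) *\<^sub>R \<delta>) = (\<Sum>i\<in>{1..8}. of_int \<bar>n i\<bar> *\<^sub>R e8_root i)"
      by (simp add: sum.reindex[OF inj_on_e8_root] c_def inv_into_f_f[OF inj_on_e8_root])
    have \<alpha>: "\<alpha> = (\<Sum>i\<in>{1..8}. of_int (n i) *\<^sub>R e8_root i)" by (simp add: v scalar_ext_icosian n_def)
    have len: "length (e8_coords v) = 8" by (cases v) simp
    consider "\<forall>i\<in>{1..8}. \<bar>n i\<bar> = n i" | "\<forall>i\<in>{1..8}. \<bar>n i\<bar> = - n i"
    proof (cases "list_all (\<lambda>x. 0 \<le> x) (e8_coords v)")
      case True
      then have "\<forall>i\<in>{1..8}. \<bar>n i\<bar> = n i" by (auto simp: list_all_length len n_def)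
      then show ?thesis using that by blast
    next
      case False
      then have "list_all (\<lambda>x. x \<le> 0) (e8_coords v)" using v(2) by (simp add: same_sign_def)
      then have "\<forall>i\<in>{1..8}. \<bar>n i\<bar> = - n i" by (auto simp: list_all_length len n_def)
      then show ?thesis using that by blast
    qed
    then have "\<alpha> = (\<Sum>i\<in>{1..8}. of_int \<bar>n i\<bar> *\<^sub>R e8_root i) \<or>
               \<alpha> = - (\<Sum>i\<in>{1..8}. of_int \<bar>n i\<bar> *\<^sub>R e8_root i)"
    proof cases
      case 1
      then have "\<alpha> = (\<Sum>i\<in>{1..8}. of_int \<bar>n i\<bar> *\<^sub>R e8_root i)"
        unfolding \<alpha> by (intro sum.cong) simp_all
      then show ?thesis ..
    next
      case 2
      then have "\<alpha> = - (\<Sum>i\<in>{1..8}. of_int \<bar>n i\<bar> *\<^sub>R e8_root i)"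
        unfolding \<alpha> sum_negf[symmetric] by (intro sum.cong) simp_all
      then show ?thesis ..
    qed
    then show ?thesis by (intro exI[of _ c]) (simp only: c)
  qed
  moreover have "e8_root ` {1..8} \<subseteq> scalar_ext ` Phi" using e8_simple_Phi by (auto simp: e8_root_def)
  ultimately show ?thesis using independent_e8 by (simp add: base_of_def)
qed

lemma root_system_Phi: "root_system reduced_form (scalar_ext ` Phi)"
proof -
  have form: "reduced_form (scalar_ext x) (scalar_ext y) = reduced_inner x y" if "x \<in> Phi" "y \<in> Phi" for x y
    using that Phi_even_Q_tau by (intro reduced_form_scalar_ext) auto
  have norm: "\<alpha> \<bullet> \<alpha> = 1" if "\<alpha> \<in> scalar_ext ` Phi" for \<alpha>
    using that form Phi_norm by (auto simp flip: reduced_form_inner)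
  have minus: "- \<alpha> \<in> scalar_ext ` Phi" if "\<alpha> \<in> scalar_ext ` Phi" for \<alpha>
  proof -
    obtain x where x: "x \<in> Phi" "\<alpha> = scalar_ext x" using \<open>\<alpha> \<in> _\<close> by blast
    then have "scalar_ext (- x) = - \<alpha>" using scalar_ext_scale[of "- 1" x] Phi_even_Q_tau by auto
    then show ?thesis using Phi_minus[OF x(1)] by (metis imageI)
  qed
  have "symmetric_positive_definite (reduced_form :: (real^4) \<times> (real^4) \<Rightarrow> _)"
    unfolding symmetric_positive_definite_def reduced_form_inner
    by (intro conjI allI linearI) (simp_all add: inner_commute inner_add_right)
  moreover have "0 \<notin> scalar_ext ` Phi" using norm[of 0] by auto
  moreover have "span (scalar_ext ` Phi) = UNIV"
    using span_mono[of "e8_root ` {1..8}" "scalar_ext ` Phi"] span_e8 base_of_e8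
    by (auto simp: base_of_def)
  moreover have "scalar_ext ` Phi \<inter> range (\<lambda>c. c *\<^sub>R \<alpha>) = {\<alpha>, - \<alpha>}" if "\<alpha> \<in> scalar_ext ` Phi" for \<alpha>
  proof -
    have "c = 1 \<or> c = - 1" if "c *\<^sub>R \<alpha> \<in> scalar_ext ` Phi" for c
      using norm[OF that] norm[OF \<open>\<alpha> \<in> _\<close>] by (simp add: square_eq_1_iff)
    then have "c *\<^sub>R \<alpha> \<in> {\<alpha>, - \<alpha>}" if "c *\<^sub>R \<alpha> \<in> scalar_ext ` Phi" for c
      using that by (metis insertI1 insertI2 scaleR_minus_left scaleR_one)
    then have "\<beta> \<in> {\<alpha>, - \<alpha>}" if "\<beta> \<in> scalar_ext ` Phi" "\<beta> \<in> range (\<lambda>c. c *\<^sub>R \<alpha>)" for \<beta>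
      using that by (elim rangeE) (simp only:)
    then have "scalar_ext ` Phi \<inter> range (\<lambda>c. c *\<^sub>R \<alpha>) \<subseteq> {\<alpha>, - \<alpha>}" by (simp only: subset_iff Int_iff) blast
    moreover have "\<alpha> = 1 *\<^sub>R \<alpha>" "- \<alpha> = (- 1) *\<^sub>R \<alpha>" by simp_all
    ultimately show ?thesis using minus[OF that] that by blast
  qed
  moreover have "reflect reduced_form \<alpha> ` scalar_ext ` Phi = scalar_ext ` Phi"
    if "\<alpha> \<in> scalar_ext ` Phi" for \<alpha>
  proof -
    have sub: "reflect reduced_form \<alpha> \<beta> \<in> scalar_ext ` Phi" if "\<beta> \<in> scalar_ext ` Phi" for \<beta>
      using that \<open>\<alpha> \<in> _\<close> reflect_scalar_ext by blast
    have "reflect reduced_form \<alpha> (reflect reduced_form \<alpha> \<beta>) = \<beta>" for \<beta>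
      using norm[OF that] by (simp add: reflect_def reduced_form_inner inner_diff_left algebra_simps)
    then show ?thesis using sub by (metis (no_types, lifting) image_eqI subsetI subset_antisym image_subsetI)
  qed
  ultimately show ?thesis by (simp add: root_system_def)
qed

lemma Phi_type_E8: "root_system_of_type reduced_form (scalar_ext ` Phi) 8 cartan_E8"
proof -
  have form: "reduced_form (scalar_ext x) (scalar_ext y) = reduced_inner x y" if "x \<in> Phi" "y \<in> Phi" for x y
    using that Phi_even_Q_tau by (intro reduced_form_scalar_ext) auto
  have "finite Phi" using card_Phi card.infinite by fastforce
  moreover have "2 * reduced_form \<alpha> \<beta> / reduced_form \<beta> \<beta> \<in> \<int>"
    if \<alpha>: "\<alpha> \<in> scalar_ext ` Phi" and \<beta>: "\<beta> \<in> scalar_ext ` Phi" for \<alpha> \<beta>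
  proof -
    obtain x y where xy: "x \<in> Phi" "\<alpha> = scalar_ext x" "y \<in> Phi" "\<beta> = scalar_ext y"
      using \<alpha> \<beta> by blast
    then obtain n :: int where "reduced_inner x y = of_int n / 2" using Phi_step by blast
    then have "2 * reduced_inner x y = of_int n" by simp
    then show ?thesis using xy by (simp add: form Phi_norm)
  qed
  moreover have "2 * reduced_form (e8_root i) (e8_root j) / reduced_form (e8_root j) (e8_root j)
      = of_int (cartan_E8 i j)" if "i \<in> {1..8}" "j \<in> {1..8}" for i j
    using that by (simp add: e8_gram[of i j] e8_norm)
  ultimately show ?thesis
    unfolding root_system_of_type_def using root_system_Phi inj_on_e8_root base_of_e8
    by (intro conjI exI[of _ e8_root]) auto
qed

theorem mainTheorem1:
  shows
    "card pinors = 240 \<and>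
     card H3 = 120 \<and>
     (\<forall>A\<in>pinors. \<forall>v. cl_vec (pinor_action A v) = pinor_sign A *\<^sub>R (cl_rev A * cl_vec v * A)) \<and>
     pinor_action ` pinors = H3 \<and>
     (\<forall>A\<in>pinors. \<forall>B\<in>pinors. pinor_action (A * B) = pinor_action B \<circ> pinor_action A) \<and>
     (\<forall>A\<in>pinors. A \<noteq> - A \<and> {B \<in> pinors. pinor_action B = pinor_action A} = {A, - A}) \<and>
     subgroup spinors cl3_units \<and>
     card spinors = 120 \<and>
     pinors = spinors \<union> (\<lambda>R. cl_I * R) ` spinors \<and>
     Phi \<subseteq> even_Q_tau \<and>
     card Phi = 240 \<and>
     root_system_of_type reduced_form (scalar_ext ` Phi) 8 cartan_E8"
  using card_pinors card_H3 cl_vec_pinor_action[OF pinors_versor] pinor_action_image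
    pinor_action_mult[OF pinors_versor pinors_versor] pinor_neq_minus pinor_action_fibre
    spinors_subgroup card_binary_icosahedral[folded spinors_eq] pinors_eq Phi_even_Q_tau card_Phi Phi_type_E8
  by (intro conjI ballI allI) blast+

end
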